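(* Suppose that $h\in H^\infty$ and $\|h\|_\infty=1$. The following conditions are equivalent: (i) $h$ is an inner function. (ii) For each nonconstant Blaschke product $B$, the function $Bh$ is an extreme point of $\mathrm{ball}(\mathrm{BMO})$. (iii) There exists a Blaschke product $B$ such that $Bh$ is an extreme point of $\mathrm{ball}(\mathrm{BMO})$.
   Context: $\mathbb D=\{z\in\mathbb C:|z|<1\}$, $\mathbb T=\partial\mathbb D$, $m$ is normalized arc length measure on $\mathbb T$, $L^p=L^p(\mathbb T,m)$ (complex-valued functions). For $f\in L^1$, the Poisson integral is $\mathcal Pf(z)=\int_{\mathbb T}f(\zeta)\frac{1-|z|^2}{|\zeta-z|^2}\,dm(\zeta)$, $z\in\mathbb D$. $H^\infty$ is the set of $f\in L^\infty$ with $\mathcal Pf$ analytic on $\mathbb D$; such $f$ is identified with its analytic extension $\mathcal Pf$. An inner function is a function $I\in H^\infty$ with $|I|=1$ a.e. on $\mathbb T$. A Blaschke product is a function $B(z)=\prod_j\frac{|z_j|}{z_j}\frac{z_j-z}{1-\bar z_jz}$, where $\{z_j\}\subset\mathbb D$ is a (possibly finite or empty) sequence with $\sum_j(1-|z_j|)<\infty$, and $|z_j|/z_j:=-1$ if $z_j=0$. For $f\in L^2$ put $\Phi_f(z)=\mathcal P(|f|^2)(z)-|\mathcal Pf(z)|^2$, $z\in\mathbb D$, and $\|f\|_G=\sup_{z\in\mathbb D}\Phi_f(z)^{1/2}$ (the Garsia norm). $\mathrm{BMO}$ is the set of $f\in L^2$ with $\|f\|_G<\infty$. The functions annihilated by $\|\cdot\|_G$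 are the constants, and $\mathrm{BMO}$ is regarded here as a quotient space modulo constants, normed by $\|\cdot\|_G$; an element $f$ of $\mathrm{BMO}$ is understood as the coset $f+\mathbb C$. For a normed space $X$, $\mathrm{ball}(X)=\{x\in X:\|x\|\le1\}$; $x\in\mathrm{ball}(X)$ is an extreme point of $\mathrm{ball}(X)$ if it is not of the form $x=\frac12(u+v)$ with two distinct points $u,v\in\mathrm{ball}(X)$. *)

theory Defs
  imports "HOL-Analysis.Analysis" "HOL-Probability.Essential_Supremum"
begin

text \<open>Normalized arc length on the unit circle. Its space is the circle, so only the values on
  the circle of a function \<open>complex \<Rightarrow> 'b\<close> matter for measurability and integrals. Elements of
  the Lebesgue spaces are represented by functions; all notions below are insensitive to changes
  on null sets.\<close>

definition circle_measure :: "complex measure" where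
  "circle_measure =
     distr (uniform_measure lborel {0..2 * pi}) (restrict_space borel (sphere 0 1)) cis"

definition L2 :: "(complex \<Rightarrow> complex) set" where
  "L2 = {f \<in> borel_measurable circle_measure. integrable circle_measure (\<lambda>\<zeta>. (cmod (f \<zeta>))\<^sup>2)}"

definition Linf_norm :: "(complex \<Rightarrow> complex) \<Rightarrow> ereal" where
  "Linf_norm f = esssup circle_measure (\<lambda>\<zeta>. ereal (cmod (f \<zeta>)))"

definition Linf :: "(complex \<Rightarrow> complex) set" where
  "Linf = {f \<in> borel_measurable circle_measure. Linf_norm f < \<infinity>}"

definition poisson :: "(complex \<Rightarrow> 'b::{banach, second_countable_topology}) \<Rightarrow> complex \<Rightarrow> 'b" where
  "poisson f z =
     (LINT \<zeta>|circle_measure. ((1 - (cmod z)\<^sup>2) / (cmod (\<zeta> - z))\<^sup>2) *\<^sub>R f \<zeta>)"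

definition Hinf :: "(complex \<Rightarrow> complex) set" where
  "Hinf = {f \<in> Linf. poisson f analytic_on ball 0 1}"

definition inner_function :: "(complex \<Rightarrow> complex) \<Rightarrow> bool" where
  "inner_function f \<longleftrightarrow> f \<in> Hinf \<and> (AE \<zeta> in circle_measure. cmod (f \<zeta>) = 1)"

definition blaschke_factor :: "complex \<Rightarrow> complex \<Rightarrow> complex" where
  "blaschke_factor a z =
     (if a = 0 then -1 else of_real (cmod a) / a) * ((a - z) / (1 - cnj a * z))"

text \<open>A possibly finite or empty sequence of zeros is a family indexed by a set \<open>J\<close> of natural
  numbers; the missing indices contribute the factor 1. Convergence is in the sense of
  \<^const>\<open>has_prod\<close>, which allows finitely many vanishing factors.\<close>

definition blaschke_product_on_disc :: "(complex \<Rightarrow> complex) \<Rightarrow> bool" where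
  "blaschke_product_on_disc F \<longleftrightarrow>
     (\<exists>(J :: nat set) (a :: nat \<Rightarrow> complex).
        (\<forall>j\<in>J. a j \<in> ball 0 1) \<and> (\<lambda>j. 1 - cmod (a j)) summable_on J \<and>
        (\<forall>z\<in>ball 0 1. (\<lambda>j. if j \<in> J then blaschke_factor (a j) z else 1) has_prod F z))"

text \<open>Blaschke products as elements of \<^const>\<open>Hinf\<close>: boundary functions, identified with
  their analytic extension by the Poisson integral.\<close>

definition blaschke_product :: "(complex \<Rightarrow> complex) \<Rightarrow> bool" where
  "blaschke_product B \<longleftrightarrow> B \<in> Hinf \<and> blaschke_product_on_disc (poisson B)"

definition Phi :: "(complex \<Rightarrow> complex) \<Rightarrow> complex \<Rightarrow> real" where
  "Phi f z = poisson (\<lambda>\<zeta>. (cmod (f \<zeta>))\<^sup>2) z - (cmod (poisson f z))\<^sup>2"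

definition garsia_norm :: "(complex \<Rightarrow> complex) \<Rightarrow> ereal" where
  "garsia_norm f = (SUP z\<in>ball 0 1. ereal (sqrt (Phi f z)))"

definition BMO :: "(complex \<Rightarrow> complex) set" where
  "BMO = {f \<in> L2. garsia_norm f < \<infinity>}"

text \<open>Equality of the cosets modulo constants (and null sets). The quotient space is handled
  through representatives: points are distinct iff their representatives are not related.\<close>

definition bmo_eq :: "(complex \<Rightarrow> complex) \<Rightarrow> (complex \<Rightarrow> complex) \<Rightarrow> bool" where
  "bmo_eq f g \<longleftrightarrow> (\<exists>c. AE \<zeta> in circle_measure. f \<zeta> = g \<zeta> + c)"

definition ball_BMO :: "(complex \<Rightarrow> complex) set" where
  "ball_BMO = {f \<in> BMO. garsia_norm f \<le> 1}"

definition extreme_point_ball_BMO :: "(complex \<Rightarrow> complex) \<Rightarrow> bool" where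
  "extreme_point_ball_BMO f \<longleftrightarrow>
     f \<in> ball_BMO \<and>
     \<not> (\<exists>u\<in>ball_BMO. \<exists>v\<in>ball_BMO. \<not> bmo_eq u v \<and> bmo_eq f (\<lambda>\<zeta>. (u \<zeta> + v \<zeta>) / 2))"

end

theory Submission
  imports Defs "HOL-Probability.Probability_Measure" "HOL-Complex_Analysis.Cauchy_Integral_Formula"
begin

text \<open>
  Two observations about the Garsia norm carry the proof. First, the closed unit ball of \<open>L\<^sup>\<infinity>\<close> lies
  in the unit ball of BMO, since \<open>\<Phi>\<^sub>f\<close> is at most the Poisson integral of \<open>\<bar>f\<bar>\<^sup>2\<close>. Secondly, \<open>\<Phi>\<^sub>f(z)\<close>
  is the variance of \<open>f\<close> with respect to the Poisson kernel at \<open>z\<close>, so it is a quadratic form that vanishes on the constants alone.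

  Since \<open>B\<close> is unimodular on the circle, \<open>f = Bh\<close> is unimodular exactly when \<open>h\<close> is inner. If it is not,
  then \<open>f\<close> is not extreme. Its slack \<open>1 - \<bar>f\<bar>\<close>, possibly multiplied by the
  coordinate function \<open>\<zeta>\<close> to make it nonconstant, is a perturbation that keeps \<open>f\<close> in the unit ball of
  \<open>L\<^sup>\<infinity>\<close> in both directions (\<open>extreme_unimodular\<close>). It is admissible although it depends on \<open>\<bar>f\<bar>\<close>, because
  BMO contains all bounded functions and not just the analytic ones.

  Conversely, let \<open>h\<close> be inner and let \<open>B\<close> have a zero \<open>a\<close>. Then \<open>f = Bh\<close> is unimodular with extension vanishing at \<open>a\<close>,
  so \<open>\<Phi>\<^sub>f(a) = 1\<close>, the largest value allowed in the ball. A quadratic form cannot attain its bound at the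
  midpoint of a segment unless it vanishes on the direction of the segment, and so \<open>f\<close> is extreme
  (\<open>unimodular_extreme\<close>).

  Two classical facts about boundary values are needed on the way: a Blaschke product is unimodular on the
  circle (\<open>blaschke_product_unimodular\<close>), and Poisson extension is multiplicative on bounded
  analytic functions (\<open>poisson_mult\<close>), which makes the extension of \<open>Bh\<close> vanish at \<open>a\<close>. Both rest on the
  \<open>L\<^sup>1\<close> convergence of dilated Poisson integrals to the boundary function
  (\<open>poisson_dilate_tendsto_L1\<close>) and on the reproducing property of the Poisson kernel for analytic
  functions (\<open>poisson_holomorphic\<close>). Finally, the coordinate function \<open>\<zeta>\<close> is a nonconstant
  Blaschke product, so the condition on all nonconstant \<open>B\<close> implies the existence of one.
\<close>

section \<open>Arc length on the circle\<close>

lemma space_circle_measure [simp]: "space circle_measure = sphere 0 1"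
  by (simp add: circle_measure_def space_restrict_space)

lemma sets_circle_measure [measurable_cong]:
  "sets circle_measure = sets (restrict_space borel (sphere 0 1))"
  by (simp add: circle_measure_def)

lemma borel_measurable_circle_iff:
  "f \<in> borel_measurable circle_measure \<longleftrightarrow> f \<in> borel_measurable (restrict_space borel (sphere 0 1))"
  unfolding measurable_cong_sets[OF sets_circle_measure refl] ..

lemma borel_measurable_circle:
  "f \<in> borel_measurable borel \<Longrightarrow> f \<in> borel_measurable circle_measure"
  unfolding borel_measurable_circle_iff by (rule measurable_restrict_space1)

lemma borel_measurable_circle_id [measurable]: "(\<lambda>\<zeta>. \<zeta>) \<in> borel_measurable circle_measure"
  by (rule borel_measurable_circle) simp

lemma cis_measurable_circle: "cis \<in> borel \<rightarrow>\<^sub>M restrict_space borel (sphere 0 1)"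
proof (rule measurable_restrict_space2)
  show "cis \<in> borel_measurable borel"
    by (intro borel_measurable_continuous_onI continuous_intros)
qed auto

lemma cis_measurable_circle_measure [measurable]: "cis \<in> borel \<rightarrow>\<^sub>M circle_measure"
  unfolding measurable_cong_sets[OF refl sets_circle_measure] by (rule cis_measurable_circle)

lemma sets_uniform_lborel: "sets (uniform_measure lborel {0..2 * pi}) = sets (borel :: real measure)"
  by simp

lemma cis_measurable_uniform:
  "cis \<in> uniform_measure lborel {0..2 * pi} \<rightarrow>\<^sub>M restrict_space borel (sphere 0 1)"
  unfolding measurable_cong_sets[OF sets_uniform_lborel refl] by (rule cis_measurable_circle)

lemma prob_space_circle_measure: "prob_space circle_measure"
  unfolding circle_measure_def
proof (rule prob_space.prob_space_distr)
  show "prob_space (uniform_measure lborel {0..2 * pi})"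
    by (rule prob_space_uniform_measure) auto
qed (rule cis_measurable_uniform)

interpretation circle: prob_space circle_measure
  by (rule prob_space_circle_measure)

lemma uniform_measure_eq_density:
  "uniform_measure lborel {0..2 * pi} = density lborel (\<lambda>t. ennreal (indicator {0..2 * pi} t / (2 * pi)))"
  unfolding uniform_measure_def
proof (rule arg_cong[where f = "density lborel"], rule ext)
  fix t :: real
  show "indicator {0..2 * pi} t / emeasure lborel {0..2 * pi} = ennreal (indicator {0..2 * pi} t / (2 * pi))"
    using divide_ennreal[of 1 "2 * pi"] by (cases "t \<in> {0..2 * pi}") simp_all
qed

lemma circle_integral_eq:
  fixes f :: "complex \<Rightarrow> 'b::{banach, second_countable_topology}"
  assumes [measurable]: "f \<in> borel_measurable circle_measure"
  shows "integral\<^sup>L circle_measure f = (1 / (2 * pi)) *\<^sub>R (LINT t:{0..2 * pi}|lborel. f (cis t))"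
proof -
  have f: "f \<in> borel_measurable (restrict_space borel (sphere 0 1))"
    using assms by (simp only: borel_measurable_circle_iff)
  have "integral\<^sup>L circle_measure f = (LINT t|uniform_measure lborel {0..2 * pi}. f (cis t))"
    unfolding circle_measure_def by (rule integral_distr[OF cis_measurable_uniform f])
  also have "\<dots> = (LINT t|lborel. (indicator {0..2 * pi} t / (2 * pi)) *\<^sub>R f (cis t))"
    unfolding uniform_measure_eq_density
    by (rule integral_density) auto
  also have "\<dots> = (LINT t|lborel. (1 / (2 * pi)) *\<^sub>R (indicator {0..2 * pi} t *\<^sub>R f (cis t)))"
    by (rule Bochner_Integration.integral_cong) auto
  also have "\<dots> = (1 / (2 * pi)) *\<^sub>R (LINT t|lborel. indicator {0..2 * pi} t *\<^sub>R f (cis t))"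
    by (rule integral_scaleR_right)
  finally show ?thesis
    by (simp only: set_lebesgue_integral_def)
qed

lemma AE_circle_not_one: "AE \<zeta> in circle_measure. \<zeta> \<noteq> 1"
proof -
  have "AE t in uniform_measure lborel {0..2 * pi}. cis t \<noteq> 1"
  proof (rule AE_uniform_measureI)
    have "AE t in lborel. t \<notin> {0, 2 * pi}"
      by (intro AE_not_in finite_imp_null_set_lborel) auto
    then show "AE t in lborel. t \<in> {0..2 * pi} \<longrightarrow> cis t \<noteq> 1"
    proof eventually_elim
      case (elim t)
      show ?case
      proof
        assume "t \<in> {0..2 * pi}"
        with elim have "0 < t" "t < 2 * pi" by auto
        then have "0 < sin (t / 2)"
          by (intro sin_gt_zero) auto
        then have "cos t \<noteq> 1"
          using cos_double_sin[of "t / 2"] by auto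
        then show "cis t \<noteq> 1" by (auto simp: complex_eq_iff)
      qed
    qed
  qed simp
  moreover have "{\<zeta> \<in> space (restrict_space borel (sphere 0 1)). \<zeta> \<noteq> (1::complex)}
      \<in> sets (restrict_space borel (sphere 0 1))"
    unfolding sets_restrict_space
    by (rule image_eqI[of _ _ "- {1}"]) (auto simp: space_restrict_space)
  ultimately show ?thesis
    unfolding circle_measure_def
    using AE_distr_iff[OF cis_measurable_uniform, of "\<lambda>\<zeta>. \<zeta> \<noteq> 1"] by blast
qed

section \<open>The Poisson kernel\<close>

definition poisson_kernel :: "complex \<Rightarrow> complex \<Rightarrow> real" where
  "poisson_kernel z \<zeta> = (1 - (cmod z)\<^sup>2) / (cmod (\<zeta> - z))\<^sup>2"

lemma poisson_eq: "poisson f z = (LINT \<zeta>|circle_measure. poisson_kernel z \<zeta> *\<^sub>R f \<zeta>)"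
  by (simp add: poisson_def poisson_kernel_def)

lemma poisson_kernel_measurable [measurable]: "poisson_kernel z \<in> borel_measurable circle_measure"
  unfolding poisson_kernel_def by measurable

lemma poisson_kernel_pos: "cmod z < 1 \<Longrightarrow> cmod \<zeta> = 1 \<Longrightarrow> 0 < poisson_kernel z \<zeta>"
  unfolding poisson_kernel_def by (intro divide_pos_pos) (auto simp: abs_square_less_1)

lemma poisson_kernel_le:
  assumes "cmod z < 1" "cmod \<zeta> = 1" shows "poisson_kernel z \<zeta> \<le> 1 / (1 - cmod z)\<^sup>2"
  unfolding poisson_kernel_def
proof (rule frac_le)
  show "(1 - cmod z)\<^sup>2 \<le> (cmod (\<zeta> - z))\<^sup>2"
    using norm_triangle_ineq2[of \<zeta> z] assms by (intro power_mono) auto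
qed (use assms in auto)

text \<open>For \<open>\<zeta>\<close> and \<open>\<eta>\<close> on the circle \<open>\<bar>\<eta> - r\<zeta>\<bar> = \<bar>\<zeta> - r\<eta>\<bar>\<close>: the distance depends only on \<open>r\<close> and the angle
  between the two points. By this symmetry dilated Poisson integrals do not increase the \<open>L\<^sup>1\<close> norm.\<close>

lemma poisson_kernel_symmetric:
  assumes "cmod \<zeta> = 1" "cmod \<eta> = 1"
  shows "poisson_kernel (of_real r * \<zeta>) \<eta> = poisson_kernel (of_real r * \<eta>) \<zeta>"
proof -
  have *: "(cmod (x - of_real r * y))\<^sup>2 = 1 - 2 * r * (Re x * Re y + Im x * Im y) + r\<^sup>2"
    if "cmod x = 1" "cmod y = 1" for x y
  proof -
    have "(cmod (x - of_real r * y))\<^sup>2 =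
        (cmod x)\<^sup>2 - 2 * r * (Re x * Re y + Im x * Im y) + r\<^sup>2 * (cmod y)\<^sup>2"
      unfolding cmod_power2 by (simp add: power2_eq_square algebra_simps)
    then show ?thesis
      using that by simp
  qed
  show ?thesis
    unfolding poisson_kernel_def *[OF assms] *[OF assms(2,1)]
    using assms by (simp add: norm_mult mult.commute)
qed

lemma poisson_integrable:
  fixes f :: "complex \<Rightarrow> 'b::{banach, second_countable_topology}"
  assumes "cmod z < 1" "integrable circle_measure f"
  shows "integrable circle_measure (\<lambda>\<zeta>. poisson_kernel z \<zeta> *\<^sub>R f \<zeta>)"
proof (rule Bochner_Integration.integrable_bound)
  show "integrable circle_measure (\<lambda>\<zeta>. (1 / (1 - cmod z)\<^sup>2) *\<^sub>R f \<zeta>)"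
    using assms by simp
  show "(\<lambda>\<zeta>. poisson_kernel z \<zeta> *\<^sub>R f \<zeta>) \<in> borel_measurable circle_measure"
    using assms(2) by measurable
  show "AE \<zeta> in circle_measure. norm (poisson_kernel z \<zeta> *\<^sub>R f \<zeta>) \<le> norm ((1 / (1 - cmod z)\<^sup>2) *\<^sub>R f \<zeta>)"
  proof (rule AE_I2)
    fix \<zeta> assume "\<zeta> \<in> space circle_measure"
    then have "cmod \<zeta> = 1" by simp
    then show "norm (poisson_kernel z \<zeta> *\<^sub>R f \<zeta>) \<le> norm ((1 / (1 - cmod z)\<^sup>2) *\<^sub>R f \<zeta>)"
      using poisson_kernel_le[of z \<zeta>] poisson_kernel_pos[of z \<zeta>] assms(1)
      by (simp only: norm_scaleR) (intro mult_right_mono, auto)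
  qed
qed

text \<open>On the circle \<open>\<bar>\<zeta> - z\<bar>\<^sup>2 = (\<zeta> - z)(1 - \<zeta> cnj z)/\<zeta>\<close>, so the Poisson integral of \<open>K\<close> is the Cauchy integral
  at \<open>z\<close> of \<open>L(\<zeta>) = K(\<zeta>)(1 - \<bar>z\<bar>\<^sup>2)/(1 - \<zeta> cnj z)\<close>. This \<open>L\<close> is as regular as \<open>K\<close>, because the denominator has
  no zero in the closed disc, and \<open>L(z) = K(z)\<close>. One application of Cauchy's formula therefore gives
  the reproducing property.\<close>

lemma poisson_holomorphic:
  assumes K: "continuous_on (cball 0 1) K" "K holomorphic_on ball 0 1" and z: "cmod z < 1"
  shows "poisson K z = K z"
proof -
  define L where "L \<zeta> = K \<zeta> * of_real (1 - (cmod z)\<^sup>2) / (1 - cnj z * \<zeta>)" for \<zeta>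
  have nz: "1 - cnj z * \<zeta> \<noteq> 0" if "cmod \<zeta> \<le> 1" for \<zeta>
  proof
    assume "1 - cnj z * \<zeta> = 0"
    then have "1 = cmod (cnj z * \<zeta>)" by simp
    also have "\<dots> \<le> cmod z * 1" unfolding norm_mult complex_mod_cnj
      using that by (intro mult_left_mono) auto
    finally show False using z by simp
  qed
  have "((\<lambda>u. L u / (u - z)) has_contour_integral 2 * of_real pi * \<i> * L z) (circlepath 0 1)"
  proof (rule Cauchy_integral_circlepath)
    show "continuous_on (cball 0 1) L" unfolding L_def
      using nz K by (intro continuous_intros) auto
    show "L holomorphic_on ball 0 1" unfolding L_def
      using nz K by (intro holomorphic_intros) auto
  qed (use z in auto)
  moreover have "L z = K z"
  proof -
    have "1 - cnj z * z = of_real (1 - (cmod z)\<^sup>2)"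
      using complex_norm_square[of z] by (simp add: mult.commute)
    then show ?thesis using nz[of z] z by (simp add: L_def)
  qed
  ultimately have "((\<lambda>t. L (cis t) / (cis t - z) * \<i> * cis t) has_integral 2 * of_real pi * \<i> * K z) {0..2*pi}"
    by (simp add: circlepath_def has_contour_integral_part_circlepath_iff)
  then have "((\<lambda>t. (1/\<i>) * (L (cis t) / (cis t - z) * \<i> * cis t)) has_integral (1/\<i>) * (2 * of_real pi * \<i> * K z)) {0..2*pi}"
    by (rule has_integral_mult_right)
  then have "((\<lambda>t. L (cis t) * cis t / (cis t - z)) has_integral 2 * of_real pi * K z) {0..2*pi}"
    by (simp add: field_simps)
  moreover have "L (cis t) * cis t / (cis t - z) = poisson_kernel z (cis t) *\<^sub>R K (cis t)" for t
  proof -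
    have "(cis t - z) * (1 - cnj z * cis t) = cis t * ((cis t - z) * cnj (cis t - z))"
      by (simp add: algebra_simps cis_cnj cis_mult)
    also have "(cis t - z) * cnj (cis t - z) = of_real ((cmod (cis t - z))\<^sup>2)"
      using complex_norm_square[of "cis t - z"] by simp
    finally have "(cis t - z) * (1 - cnj z * cis t) = cis t * of_real ((cmod (cis t - z))\<^sup>2)" .
    then have "L (cis t) * cis t / (cis t - z) = (K (cis t) * of_real (1 - (cmod z)\<^sup>2) * cis t) / (cis t * of_real ((cmod (cis t - z))\<^sup>2))"
      by (simp add: L_def mult.commute)
    then show ?thesis
      by (simp add: poisson_kernel_def scaleR_conv_of_real)
  qed
  ultimately have hi: "((\<lambda>t. poisson_kernel z (cis t) *\<^sub>R K (cis t)) has_integral 2 * of_real pi * K z) {0..2*pi}"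
    by simp
  have contK: "continuous_on (sphere 0 1) K"
    using K(1) by (rule continuous_on_subset) auto
  have "continuous_on {0..2*pi} (\<lambda>t. poisson_kernel z (cis t) *\<^sub>R K (cis t))"
    unfolding poisson_kernel_def
  proof (intro continuous_intros)
    show "continuous_on {0..2*pi} (\<lambda>x. K (cis x))"
      by (rule continuous_on_compose2[OF contK]) (auto intro!: continuous_intros)
    show "\<forall>x\<in>{0..2*pi}. (cmod (cis x - z))\<^sup>2 \<noteq> 0"
      using z by auto
  qed
  then have "set_integrable lborel {0..2*pi} (\<lambda>t. poisson_kernel z (cis t) *\<^sub>R K (cis t))"
    by (rule borel_integrable_atLeastAtMost')
  from set_borel_integral_eq_integral(2)[OF this] hi
  have "(LINT t:{0..2*pi}|lborel. poisson_kernel z (cis t) *\<^sub>R K (cis t)) = 2 * of_real pi * K z"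
    by (simp add: integral_unique)
  moreover have "K \<in> borel_measurable circle_measure"
    unfolding borel_measurable_circle_iff using contK by (rule borel_measurable_continuous_on_restrict)
  ultimately show ?thesis
    unfolding poisson_eq by (subst circle_integral_eq) (auto simp: scaleR_conv_of_real)
qed

lemma poisson_const [simp]:
  fixes c :: complex
  assumes "cmod z < 1" shows "poisson (\<lambda>\<zeta>. c) z = c"
  using assms by (intro poisson_holomorphic) auto

lemma integral_poisson_kernel:
  assumes "cmod z < 1" shows "(LINT \<zeta>|circle_measure. poisson_kernel z \<zeta>) = 1"
proof -
  have "complex_of_real (LINT \<zeta>|circle_measure. poisson_kernel z \<zeta>) = poisson (\<lambda>\<zeta>. 1) z"
    unfolding poisson_eq by (simp add: scaleR_conv_of_real flip: integral_complex_of_real)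
  then show ?thesis using assms by simp
qed

lemma poisson_kernel_integrable:
  assumes "cmod z < 1" shows "integrable circle_measure (poisson_kernel z)"
  using poisson_integrable[OF assms, of "\<lambda>_. 1::real"] by simp

lemma poisson_cong_AE:
  fixes f g :: "complex \<Rightarrow> 'b::{banach, second_countable_topology}"
  assumes "AE \<zeta> in circle_measure. f \<zeta> = g \<zeta>"
    and [measurable]: "f \<in> borel_measurable circle_measure" "g \<in> borel_measurable circle_measure"
  shows "poisson f z = poisson g z"
  unfolding poisson_eq using assms(1) by (intro integral_cong_AE) auto

lemma poisson_add:
  fixes f g :: "complex \<Rightarrow> 'b::{banach, second_countable_topology}"
  assumes "cmod z < 1" "integrable circle_measure f" "integrable circle_measure g"
  shows "poisson (\<lambda>\<zeta>. f \<zeta> + g \<zeta>) z = poisson f z + poisson g z"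
  unfolding poisson_eq scaleR_add_right
  using assms by (intro Bochner_Integration.integral_add poisson_integrable)

lemma poisson_diff:
  fixes f g :: "complex \<Rightarrow> 'b::{banach, second_countable_topology}"
  assumes "cmod z < 1" "integrable circle_measure f" "integrable circle_measure g"
  shows "poisson (\<lambda>\<zeta>. f \<zeta> - g \<zeta>) z = poisson f z - poisson g z"
  unfolding poisson_eq scaleR_diff_right
  using assms by (intro Bochner_Integration.integral_diff poisson_integrable)

lemma norm_poisson_le:
  fixes f :: "complex \<Rightarrow> 'b::{banach, second_countable_topology}"
  assumes "cmod z < 1"
  shows "norm (poisson f z) \<le> poisson (\<lambda>\<zeta>. norm (f \<zeta>)) z"
proof -
  have "norm (poisson f z) \<le> (LINT \<zeta>|circle_measure. norm (poisson_kernel z \<zeta> *\<^sub>R f \<zeta>))"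
    unfolding poisson_eq by (rule integral_norm_bound)
  also have "\<dots> = poisson (\<lambda>\<zeta>. norm (f \<zeta>)) z"
    unfolding poisson_eq
    by (rule Bochner_Integration.integral_cong) (auto dest: poisson_kernel_pos[OF assms])
  finally show ?thesis .
qed

lemma poisson_mono_AE:
  fixes f g :: "complex \<Rightarrow> real"
  assumes "cmod z < 1" "integrable circle_measure f" "integrable circle_measure g"
    and le: "AE \<zeta> in circle_measure. f \<zeta> \<le> g \<zeta>"
  shows "poisson f z \<le> poisson g z"
  unfolding poisson_eq
proof (rule integral_mono_AE)
  show "AE \<zeta> in circle_measure. poisson_kernel z \<zeta> *\<^sub>R f \<zeta> \<le> poisson_kernel z \<zeta> *\<^sub>R g \<zeta>"
    using le AE_space
  proof eventually_elim
    case (elim \<zeta>)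
    then show ?case
      using poisson_kernel_pos[OF assms(1), of \<zeta>] by (simp add: mult_left_mono)
  qed
next
  show "integrable circle_measure (\<lambda>\<zeta>. poisson_kernel z \<zeta> *\<^sub>R f \<zeta>)"
    by (rule poisson_integrable) fact+
  show "integrable circle_measure (\<lambda>\<zeta>. poisson_kernel z \<zeta> *\<^sub>R g \<zeta>)"
    by (rule poisson_integrable) fact+
qed

lemma poisson_real_const [simp]:
  fixes c :: real
  assumes "cmod z < 1" shows "poisson (\<lambda>\<zeta>. c) z = c"
  unfolding poisson_eq using integral_poisson_kernel[OF assms] by simp

lemma norm_poisson_le_const:
  fixes f :: "complex \<Rightarrow> complex"
  assumes "cmod z < 1" and [measurable]: "f \<in> borel_measurable circle_measure"
    and M: "AE \<zeta> in circle_measure. cmod (f \<zeta>) \<le> M"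
  shows "cmod (poisson f z) \<le> M"
proof -
  have "integrable circle_measure (\<lambda>\<zeta>. cmod (f \<zeta>))"
    using M by (intro circle.integrable_const_bound[of _ M]) auto
  then have "poisson (\<lambda>\<zeta>. cmod (f \<zeta>)) z \<le> poisson (\<lambda>\<zeta>. M) z"
    using M by (intro poisson_mono_AE assms(1)) auto
  then show ?thesis
    using norm_poisson_le[OF assms(1), of f] assms(1) by simp
qed

section \<open>Radial convergence of Poisson integrals\<close>

lemma poisson_kernel_pair_measurable [measurable]:
  "(\<lambda>(\<zeta>, \<eta>). poisson_kernel (of_real r * \<zeta>) \<eta>) \<in> borel_measurable (circle_measure \<Otimes>\<^sub>M circle_measure)"
  unfolding poisson_kernel_def by measurable

lemma poisson_dilate_measurable:
  fixes f :: "complex \<Rightarrow> complex"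
  assumes [measurable]: "f \<in> borel_measurable circle_measure"
  shows "(\<lambda>\<zeta>. poisson f (of_real r * \<zeta>)) \<in> borel_measurable circle_measure"
  unfolding poisson_eq by measurable

text \<open>Move the modulus inside the integral, exchange the two integrations by Tonelli, and use the
  symmetry of the kernel: its integral in the other variable is again 1.\<close>

lemma poisson_dilate_L1:
  fixes f :: "complex \<Rightarrow> complex"
  assumes r: "0 \<le> r" "r < 1" and f: "integrable circle_measure f"
  shows "integrable circle_measure (\<lambda>\<zeta>. poisson f (of_real r * \<zeta>))" (is ?A)
    and "(LINT \<zeta>|circle_measure. cmod (poisson f (of_real r * \<zeta>))) \<le> (LINT \<zeta>|circle_measure. cmod (f \<zeta>))" (is ?B)
proof -
  have [measurable]: "f \<in> borel_measurable circle_measure" using f by auto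
  note [measurable] = poisson_dilate_measurable
  have lt: "cmod (of_real r * \<zeta>) < 1" if "cmod \<zeta> = 1" for \<zeta>
    using r that by (simp add: norm_mult)
  interpret pair_sigma_finite circle_measure circle_measure ..
  have "(\<integral>\<^sup>+\<zeta>. ennreal (cmod (poisson f (of_real r * \<zeta>))) \<partial>circle_measure)
      \<le> (\<integral>\<^sup>+\<zeta>. \<integral>\<^sup>+\<eta>. ennreal (poisson_kernel (of_real r * \<zeta>) \<eta> * cmod (f \<eta>)) \<partial>circle_measure \<partial>circle_measure)"
  proof (rule nn_integral_mono)
    fix \<zeta> assume "\<zeta> \<in> space circle_measure"
    then have \<zeta>: "cmod \<zeta> = 1" by simp
    have "ennreal (cmod (poisson f (of_real r * \<zeta>)))
        \<le> (\<integral>\<^sup>+\<eta>. ennreal (cmod (poisson_kernel (of_real r * \<zeta>) \<eta> *\<^sub>R f \<eta>)) \<partial>circle_measure)"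
      unfolding poisson_eq
      by (rule integral_norm_bound_ennreal) (intro poisson_integrable lt \<zeta> f)
    also have "\<dots> = (\<integral>\<^sup>+\<eta>. ennreal (poisson_kernel (of_real r * \<zeta>) \<eta> * cmod (f \<eta>)) \<partial>circle_measure)"
      using poisson_kernel_pos[OF lt[OF \<zeta>]] by (intro nn_integral_cong) (auto simp: less_imp_le)
    finally show "ennreal (cmod (poisson f (of_real r * \<zeta>))) \<le> \<dots>" .
  qed
  also have "\<dots> = (\<integral>\<^sup>+\<eta>. \<integral>\<^sup>+\<zeta>. ennreal (poisson_kernel (of_real r * \<zeta>) \<eta> * cmod (f \<eta>)) \<partial>circle_measure \<partial>circle_measure)"
    by (rule Fubini'[symmetric]) measurable
  also have "\<dots> = (\<integral>\<^sup>+\<eta>. ennreal (cmod (f \<eta>)) \<partial>circle_measure)"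
  proof (rule nn_integral_cong)
    fix \<eta> assume "\<eta> \<in> space circle_measure"
    then have \<eta>: "cmod \<eta> = 1" by simp
    have "(\<integral>\<^sup>+\<zeta>. ennreal (poisson_kernel (of_real r * \<zeta>) \<eta> * cmod (f \<eta>)) \<partial>circle_measure)
        = (\<integral>\<^sup>+\<zeta>. ennreal (poisson_kernel (of_real r * \<eta>) \<zeta> * cmod (f \<eta>)) \<partial>circle_measure)"
      using \<eta> by (intro nn_integral_cong) (auto simp: poisson_kernel_symmetric)
    also have "\<dots> = ennreal (LINT \<zeta>|circle_measure. poisson_kernel (of_real r * \<eta>) \<zeta> * cmod (f \<eta>))"
    proof (rule nn_integral_eq_integral)
      show "integrable circle_measure (\<lambda>\<zeta>. poisson_kernel (of_real r * \<eta>) \<zeta> * cmod (f \<eta>))"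
        using poisson_kernel_integrable[OF lt[OF \<eta>]] by simp
      show "AE \<zeta> in circle_measure. 0 \<le> poisson_kernel (of_real r * \<eta>) \<zeta> * cmod (f \<eta>)"
        using poisson_kernel_pos[OF lt[OF \<eta>]] by (intro AE_I2) (auto simp: less_imp_le)
    qed
    also have "(LINT \<zeta>|circle_measure. poisson_kernel (of_real r * \<eta>) \<zeta> * cmod (f \<eta>)) = cmod (f \<eta>)"
      using integral_poisson_kernel[OF lt[OF \<eta>]] by simp
    finally show "(\<integral>\<^sup>+\<zeta>. ennreal (poisson_kernel (of_real r * \<zeta>) \<eta> * cmod (f \<eta>)) \<partial>circle_measure) = ennreal (cmod (f \<eta>))" .
  qed
  finally have *: "(\<integral>\<^sup>+\<zeta>. ennreal (cmod (poisson f (of_real r * \<zeta>))) \<partial>circle_measure)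
      \<le> (\<integral>\<^sup>+\<eta>. ennreal (cmod (f \<eta>)) \<partial>circle_measure)" .
  also have **: "\<dots> = ennreal (LINT \<eta>|circle_measure. cmod (f \<eta>))"
    using f by (intro nn_integral_eq_integral) auto
  finally have le: "(\<integral>\<^sup>+\<zeta>. ennreal (cmod (poisson f (of_real r * \<zeta>))) \<partial>circle_measure)
      \<le> ennreal (LINT \<eta>|circle_measure. cmod (f \<eta>))" .
  then show A: ?A
    by (intro integrableI_bounded) (auto intro: le_less_trans)
  have "(\<integral>\<^sup>+\<zeta>. ennreal (cmod (poisson f (of_real r * \<zeta>))) \<partial>circle_measure)
      = ennreal (LINT \<zeta>|circle_measure. cmod (poisson f (of_real r * \<zeta>)))"
    using A by (intro nn_integral_eq_integral) auto
  with le show ?B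
    by (simp add: integral_nonneg_AE)
qed

text \<open>Of the circle measure weighted by the kernel at \<open>r\<zeta>\<close>, the part away from \<open>\<zeta>\<close> vanishes as \<open>r\<close> tends to 1,
  and near \<open>\<zeta>\<close> the function is almost constant. Continuity is asked for at the single
  point \<open>\<zeta>\<close>, because the approximating functions used below may jump at 1.\<close>

lemma poisson_dilate_tendsto_continuous:
  fixes f :: "complex \<Rightarrow> complex"
  assumes [measurable]: "f \<in> borel_measurable circle_measure"
    and M: "\<And>\<eta>. cmod \<eta> = 1 \<Longrightarrow> cmod (f \<eta>) \<le> M"
    and \<zeta>: "cmod \<zeta> = 1" "isCont f \<zeta>"
    and r: "\<And>n. 0 \<le> r n" "\<And>n. r n < 1" "r \<longlonglongrightarrow> 1"
  shows "(\<lambda>n. poisson f (of_real (r n) * \<zeta>)) \<longlonglongrightarrow> f \<zeta>"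
proof (rule LIMSEQ_I)
  fix \<epsilon> :: real assume \<epsilon>: "0 < \<epsilon>"
  have fi: "integrable circle_measure f"
    using M by (intro circle.integrable_const_bound[of _ M] AE_I2) auto
  obtain \<delta> where \<delta>: "0 < \<delta>" "\<And>\<eta>. dist \<eta> \<zeta> < \<delta> \<Longrightarrow> dist (f \<eta>) (f \<zeta>) < \<epsilon> / 2"
    using \<zeta>(2) \<epsilon> unfolding continuous_at_eps_delta by (metis half_gt_zero)
  \<comment> \<open>\<open>2 * M\<close> bounds the oscillation of \<open>f\<close>, and \<open>(1 - s\<^sup>2) * 4 / \<delta>\<^sup>2\<close> bounds the kernel outside the \<open>\<delta>\<close>-ball,
    where the distance to \<open>s\<zeta>\<close> is at least \<open>\<delta> / 2\<close> once \<open>1 - s < \<delta> / 2\<close>.\<close>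
  define C where "C = 2 * M * 4 / \<delta>\<^sup>2"
  have M0: "0 \<le> M" using order_trans[OF norm_ge_zero M[of 1]] by simp
  have bound: "cmod (poisson f (of_real s * \<zeta>) - f \<zeta>) \<le> \<epsilon> / 2 + C * (1 - s\<^sup>2)"
    if s: "0 \<le> s" "s < 1" "1 - s < \<delta> / 2" for s
  proof -
    define z where "z = of_real s * \<zeta>"
    have z: "cmod z < 1" "cmod z = s" using s \<zeta> by (auto simp: z_def norm_mult)
    have "poisson f z - f \<zeta> = poisson (\<lambda>\<eta>. f \<eta> - f \<zeta>) z"
      using z fi by (simp add: poisson_diff)
    also have "cmod \<dots> \<le> (LINT \<eta>|circle_measure. cmod (poisson_kernel z \<eta> *\<^sub>R (f \<eta> - f \<zeta>)))"
      unfolding poisson_eq by (rule integral_norm_bound)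
    also have "\<dots> \<le> (LINT \<eta>|circle_measure. poisson_kernel z \<eta> * (\<epsilon> / 2) + C * (1 - s\<^sup>2))"
    proof (rule integral_mono_AE)
      show "integrable circle_measure (\<lambda>\<eta>. cmod (poisson_kernel z \<eta> *\<^sub>R (f \<eta> - f \<zeta>)))"
        using z fi by (intro integrable_norm poisson_integrable) auto
      show "integrable circle_measure (\<lambda>\<eta>. poisson_kernel z \<eta> * (\<epsilon> / 2) + C * (1 - s\<^sup>2))"
        using poisson_kernel_integrable[OF z(1)] by simp
      show "AE \<eta> in circle_measure. cmod (poisson_kernel z \<eta> *\<^sub>R (f \<eta> - f \<zeta>))
          \<le> poisson_kernel z \<eta> * (\<epsilon> / 2) + C * (1 - s\<^sup>2)"
      proof (rule AE_I2)
        fix \<eta> assume "\<eta> \<in> space circle_measure"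
        then have \<eta>: "cmod \<eta> = 1" by simp
        have p: "0 < poisson_kernel z \<eta>" by (rule poisson_kernel_pos[OF z(1) \<eta>])
        have eq: "cmod (poisson_kernel z \<eta> *\<^sub>R (f \<eta> - f \<zeta>)) = poisson_kernel z \<eta> * cmod (f \<eta> - f \<zeta>)"
          using p by simp
        have s2: "0 \<le> 1 - s\<^sup>2" using s by (simp add: power_le_one)
        have C0: "0 \<le> C" using M0 by (simp add: C_def)
        show "cmod (poisson_kernel z \<eta> *\<^sub>R (f \<eta> - f \<zeta>)) \<le> poisson_kernel z \<eta> * (\<epsilon> / 2) + C * (1 - s\<^sup>2)"
        proof (cases "dist \<eta> \<zeta> < \<delta>")
          case True
          then have "cmod (f \<eta> - f \<zeta>) \<le> \<epsilon> / 2" using \<delta>(2)[of \<eta>] by (simp add: dist_norm)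
          then have "poisson_kernel z \<eta> * cmod (f \<eta> - f \<zeta>) \<le> poisson_kernel z \<eta> * (\<epsilon> / 2)"
            using p by (intro mult_left_mono) auto
          moreover have "0 \<le> C * (1 - s\<^sup>2)" using C0 s2 by simp
          ultimately show ?thesis unfolding eq by linarith
        next
          case False
          have "cmod (\<zeta> - z) = 1 - s"
          proof -
            have "\<zeta> - z = of_real (1 - s) * \<zeta>" by (simp add: z_def algebra_simps)
            then show ?thesis using s \<zeta> by (simp add: norm_mult del: of_real_diff)
          qed
          then have "\<delta> / 2 \<le> cmod (\<eta> - z)"
            using False s norm_triangle_ineq4[of "\<eta> - z" "\<zeta> - z"] by (simp add: dist_norm)
          then have "(\<delta> / 2)\<^sup>2 \<le> (cmod (\<eta> - z))\<^sup>2"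
            using \<delta> by (intro power_mono) auto
          then have "poisson_kernel z \<eta> \<le> (1 - s\<^sup>2) / (\<delta> / 2)\<^sup>2"
            unfolding poisson_kernel_def z(2) using s2 \<delta> by (intro frac_le) auto
          moreover have "cmod (f \<eta> - f \<zeta>) \<le> 2 * M"
            using norm_triangle_ineq4[of "f \<eta>" "f \<zeta>"] M[OF \<eta>] M[OF \<zeta>(1)] by simp
          ultimately have "poisson_kernel z \<eta> * cmod (f \<eta> - f \<zeta>) \<le> (1 - s\<^sup>2) / (\<delta> / 2)\<^sup>2 * (2 * M)"
            using p s2 by (intro mult_mono) auto
          also have "\<dots> = C * (1 - s\<^sup>2)" by (simp add: C_def power_divide)
          finally have "poisson_kernel z \<eta> * cmod (f \<eta> - f \<zeta>) \<le> C * (1 - s\<^sup>2)" .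
          moreover have "0 \<le> poisson_kernel z \<eta> * (\<epsilon> / 2)"
            using p \<epsilon> by simp
          ultimately show ?thesis unfolding eq by linarith
        qed
      qed
    qed
    also have "\<dots> = \<epsilon> / 2 + C * (1 - s\<^sup>2)"
      using poisson_kernel_integrable[OF z(1)] integral_poisson_kernel[OF z(1)] circle.prob_space
      by simp
    finally show ?thesis by (simp add: z_def)
  qed
  have "(\<lambda>n. \<epsilon> / 2 + C * (1 - (r n)\<^sup>2)) \<longlonglongrightarrow> \<epsilon> / 2 + C * (1 - 1\<^sup>2)"
    by (intro tendsto_intros r)
  then have "\<forall>\<^sub>F n in sequentially. \<epsilon> / 2 + C * (1 - (r n)\<^sup>2) < \<epsilon>"
    by (rule order_tendstoD(2)) (use \<epsilon> in simp)
  moreover have "\<forall>\<^sub>F n in sequentially. 1 - \<delta> / 2 < r n"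
    using r(3) by (rule order_tendstoD(1)) (use \<delta> in simp)
  ultimately have "\<forall>\<^sub>F n in sequentially. cmod (poisson f (of_real (r n) * \<zeta>) - f \<zeta>) < \<epsilon>"
  proof eventually_elim
    case (elim n)
    then show ?case using bound[of "r n"] r by fastforce
  qed
  then show "\<exists>N. \<forall>n\<ge>N. cmod (poisson f (of_real (r n) * \<zeta>) - f \<zeta>) < \<epsilon>"
    by (simp add: eventually_sequentially)
qed

lemma Arg2pi_borel_measurable: "Arg2pi \<in> borel_measurable borel"
proof -
  have "(\<lambda>z. if z \<in> \<real>\<^sub>\<ge>\<^sub>0 then 0 else Arg2pi z) \<in> borel_measurable borel"
  proof (rule borel_measurable_continuous_on_if)
    show "continuous_on (- \<real>\<^sub>\<ge>\<^sub>0) Arg2pi"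
      by (intro continuous_at_imp_continuous_on ballI continuous_at_Arg2pi) auto
  qed auto
  also have "(\<lambda>z. if z \<in> \<real>\<^sub>\<ge>\<^sub>0 then 0 else Arg2pi z) = Arg2pi"
    by (auto simp: fun_eq_iff Arg2pi_eq_0 nonneg_Reals_def complex_is_Real_iff)
  finally show ?thesis .
qed

text \<open>A measurable function of the angle is almost everywhere a limit of continuous functions on the
  line. Composing these with the projection onto the disc of radius \<open>M\<close> keeps the bound, and dominated convergence
  turns the convergence into convergence in \<open>L\<^sup>1\<close>. Transported to the circle by the angle
  function, the approximants stay continuous except at 1, where the angle jumps.\<close>

lemma L1_approx_circle:
  fixes f :: "complex \<Rightarrow> complex"
  assumes [measurable]: "f \<in> borel_measurable circle_measure"
    and M: "\<And>\<eta>. cmod \<eta> = 1 \<Longrightarrow> cmod (f \<eta>) \<le> M" and \<epsilon>: "0 < \<epsilon>"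
  obtains G where "G \<in> borel_measurable circle_measure" "\<And>\<eta>. cmod (G \<eta>) \<le> M"
    "\<And>\<eta>. cmod \<eta> = 1 \<Longrightarrow> \<eta> \<noteq> 1 \<Longrightarrow> isCont G \<eta>"
    "(LINT \<eta>|circle_measure. cmod (G \<eta> - f \<eta>)) < \<epsilon>"
proof -
  have M0: "0 \<le> M" using order_trans[OF norm_ge_zero M[of 1]] by simp
  have "(\<lambda>t. f (cis t)) \<in> borel_measurable lborel" by measurable
  then have "(\<lambda>t. f (cis t)) \<in> borel_measurable lebesgue"
    by (rule measurable_completion)
  then have "(\<lambda>t. f (cis t)) measurable_on UNIV"
    by (rule lebesgue_measurable_imp_measurable_on) auto
  then obtain N g where N: "negligible N" and g: "\<And>n. continuous_on UNIV (g n)"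
    and lim: "\<And>t. t \<notin> N \<Longrightarrow> (\<lambda>n. g n t) \<longlonglongrightarrow> f (cis t)"
    unfolding measurable_on_def by auto
  have "AE t in lebesgue. t \<notin> N"
    using N by (intro AE_not_in) (simp add: negligible_iff_null_sets)
  then have ae: "AE t in lborel. t \<notin> N"
    by (simp only: AE_completion_iff)
  define c where "c = closest_point (cball (0::complex) M)"
  have ne: "cball (0::complex) M \<noteq> {}" using M0 by simp
  have c_le: "cmod (c x) \<le> M" for x
    using closest_point_in_set[OF closed_cball ne, of x] by (simp add: c_def)
  have c_id: "c x = x" if "cmod x \<le> M" for x
    using that by (simp add: c_def closest_point_self)
  have c_cont: "continuous_on UNIV c"
    unfolding c_def by (rule continuous_on_closest_point[OF convex_cball closed_cball ne])
  have cg: "continuous_on UNIV (\<lambda>t. c (g n t))" for n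
    using continuous_on_compose2[OF c_cont g] by simp
  define G where "G n \<eta> = c (g n (Arg2pi \<eta>))" for n \<eta>
  have [measurable]: "(\<lambda>t. c (g n t)) \<in> borel_measurable borel" for n
    using cg by (rule borel_measurable_continuous_onI)
  have "G n \<in> borel_measurable borel" for n
    unfolding G_def using Arg2pi_borel_measurable by measurable
  then have Gm [measurable]: "G n \<in> borel_measurable circle_measure" for n
    by (rule borel_measurable_circle)
  have G_le: "cmod (G n \<eta>) \<le> M" for n \<eta>
    by (simp add: G_def c_le)
  have G_cont: "isCont (G n) \<eta>" if "cmod \<eta> = 1" "\<eta> \<noteq> 1" for n \<eta>
  proof -
    have "\<eta> \<notin> \<real>\<^sub>\<ge>\<^sub>0"
      using that by (auto simp: nonneg_Reals_def)
    then have "isCont Arg2pi \<eta>" by (rule continuous_at_Arg2pi)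
    moreover have "isCont (\<lambda>t. c (g n t)) (Arg2pi \<eta>)"
      using cg by (simp add: continuous_on_eq_continuous_at)
    ultimately show ?thesis
      unfolding G_def using isCont_o2[of \<eta> Arg2pi] by blast
  qed
  have "(\<lambda>n. LINT t|lborel. indicator {0..2*pi} t *\<^sub>R cmod (G n (cis t) - f (cis t)))
      \<longlonglongrightarrow> integral\<^sup>L lborel (\<lambda>t::real. 0::real)"
  proof (rule integral_dominated_convergence[where w = "\<lambda>t. indicator {0..2*pi} t * (2 * M)"])
    show "AE t in lborel. (\<lambda>n. indicator {0..2*pi} t *\<^sub>R cmod (G n (cis t) - f (cis t))) \<longlonglongrightarrow> 0"
    proof -
      have "AE t in lborel. t \<noteq> 2 * pi"
        by (rule AE_lborel_singleton)
      with ae show ?thesis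
      proof eventually_elim
        case (elim t)
        show ?case
        proof (cases "t \<in> {0..2*pi}")
          case True
          with elim have "Arg2pi (cis t) = t"
            using Arg2pi_unique[of 1 t "cis t"] by (simp add: cis_conv_exp)
          then have G: "G n (cis t) = c (g n t)" for n
            by (simp add: G_def)
          have "(\<lambda>n. c (g n t)) \<longlonglongrightarrow> c (f (cis t))"
            using c_cont lim[OF elim(1)]
            by (intro isCont_tendsto_compose[of _ c]) (auto simp: continuous_on_eq_continuous_at)
          then have "(\<lambda>n. G n (cis t)) \<longlonglongrightarrow> f (cis t)"
            using M[of "cis t"] by (simp add: G c_id)
          then have "(\<lambda>n. cmod (G n (cis t) - f (cis t))) \<longlonglongrightarrow> 0"
            using Lim_null tendsto_norm_zero by blast
          then show ?thesis using True by simp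
        qed simp
      qed
    qed
    show "AE t in lborel. norm (indicator {0..2*pi} t *\<^sub>R cmod (G n (cis t) - f (cis t))) \<le> indicator {0..2*pi} t * (2 * M)" for n
    proof (rule AE_I2)
      fix t
      have "cmod (G n (cis t) - f (cis t)) \<le> 2 * M"
        using norm_triangle_ineq4[of "G n (cis t)" "f (cis t)"] G_le[of n "cis t"] M[of "cis t"] by simp
      then show "norm (indicator {0..2*pi} t *\<^sub>R cmod (G n (cis t) - f (cis t))) \<le> indicator {0..2*pi} t * (2 * M)"
        by (simp add: indicator_def)
    qed
    show "integrable lborel (\<lambda>t. indicator {0..2*pi} t * (2 * M))"
      by (intro integrable_mult_left integrable_real_indicator) (auto simp: emeasure_lborel_Icc_eq)
    show "(\<lambda>t. indicator {0..2*pi} t *\<^sub>R cmod (G n (cis t) - f (cis t))) \<in> borel_measurable lborel" for n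
      by measurable
  qed simp
  then have "(\<lambda>n. (1 / (2 * pi)) *\<^sub>R (LINT t:{0..2*pi}|lborel. cmod (G n (cis t) - f (cis t))))
      \<longlonglongrightarrow> (1 / (2 * pi)) *\<^sub>R integral\<^sup>L lborel (\<lambda>t::real. 0::real)"
    unfolding set_lebesgue_integral_def by (rule tendsto_scaleR[OF tendsto_const])
  moreover have "(LINT \<eta>|circle_measure. cmod (G n \<eta> - f \<eta>))
      = (1 / (2 * pi)) *\<^sub>R (LINT t:{0..2*pi}|lborel. cmod (G n (cis t) - f (cis t)))" for n
    by (rule circle_integral_eq) measurable
  ultimately have "(\<lambda>n. LINT \<eta>|circle_measure. cmod (G n \<eta> - f \<eta>)) \<longlonglongrightarrow> 0"
    by simp
  then have "\<forall>\<^sub>F n in sequentially. (LINT \<eta>|circle_measure. cmod (G n \<eta> - f \<eta>)) < \<epsilon>"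
    using \<epsilon> by (intro order_tendstoD(2)) auto
  then obtain n where "(LINT \<eta>|circle_measure. cmod (G n \<eta> - f \<eta>)) < \<epsilon>"
    by (auto simp: eventually_sequentially)
  with Gm G_le G_cont show ?thesis by (intro that[of "G n"])
qed

text \<open>The \<open>L\<^sup>1\<close> contraction property reduces the claim to functions that are continuous off one
  point. For these, pointwise convergence and the uniform bound suffice.\<close>

lemma poisson_dilate_tendsto_L1:
  fixes f :: "complex \<Rightarrow> complex"
  assumes [measurable]: "f \<in> borel_measurable circle_measure"
    and M: "\<And>\<eta>. cmod \<eta> = 1 \<Longrightarrow> cmod (f \<eta>) \<le> M"
    and r: "\<And>n. 0 \<le> r n" "\<And>n. r n < 1" "r \<longlonglongrightarrow> 1"
  shows "(\<lambda>n. LINT \<zeta>|circle_measure. cmod (poisson f (of_real (r n) * \<zeta>) - f \<zeta>)) \<longlonglongrightarrow> 0"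
proof (rule LIMSEQ_I)
  fix \<epsilon> :: real assume \<epsilon>: "0 < \<epsilon>"
  note [measurable] = poisson_dilate_measurable
  have lt: "cmod (of_real (r n) * \<zeta>) < 1" if "cmod \<zeta> = 1" for n \<zeta>
    using r that by (simp add: norm_mult)
  obtain G where [measurable]: "G \<in> borel_measurable circle_measure" and GM: "\<And>\<eta>. cmod (G \<eta>) \<le> M"
    and Gc: "\<And>\<eta>. cmod \<eta> = 1 \<Longrightarrow> \<eta> \<noteq> 1 \<Longrightarrow> isCont G \<eta>"
    and Gf: "(LINT \<eta>|circle_measure. cmod (G \<eta> - f \<eta>)) < \<epsilon> / 3"
    using L1_approx_circle[OF assms(1) M, of "\<epsilon> / 3"] \<epsilon> by auto
  have Gi: "integrable circle_measure G"
    using GM by (intro circle.integrable_const_bound[of _ M] AE_I2) auto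
  have fi: "integrable circle_measure f"
    using M by (intro circle.integrable_const_bound[of _ M] AE_I2) auto
  have "(\<lambda>n. LINT \<zeta>|circle_measure. cmod (poisson G (of_real (r n) * \<zeta>) - G \<zeta>))
      \<longlonglongrightarrow> integral\<^sup>L circle_measure (\<lambda>\<zeta>. 0::real)"
  proof (rule integral_dominated_convergence[where w = "\<lambda>_. 2 * M"])
    show "AE \<zeta> in circle_measure. (\<lambda>n. cmod (poisson G (of_real (r n) * \<zeta>) - G \<zeta>)) \<longlonglongrightarrow> 0"
      using AE_circle_not_one AE_space
    proof eventually_elim
      case (elim \<zeta>)
      then have "(\<lambda>n. poisson G (of_real (r n) * \<zeta>)) \<longlonglongrightarrow> G \<zeta>"
        using GM Gc r by (intro poisson_dilate_tendsto_continuous[of _ M]) auto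
      then show ?case
        using Lim_null tendsto_norm_zero by blast
    qed
    show "AE \<zeta> in circle_measure. norm (cmod (poisson G (of_real (r n) * \<zeta>) - G \<zeta>)) \<le> 2 * M" for n
    proof (rule AE_I2)
      fix \<zeta> assume "\<zeta> \<in> space circle_measure"
      then have "cmod (poisson G (of_real (r n) * \<zeta>)) \<le> M"
        using GM lt by (intro norm_poisson_le_const) auto
      then show "norm (cmod (poisson G (of_real (r n) * \<zeta>) - G \<zeta>)) \<le> 2 * M"
        using norm_triangle_ineq4[of "poisson G (of_real (r n) * \<zeta>)" "G \<zeta>"] GM[of \<zeta>] by simp
    qed
    show "(\<lambda>\<zeta>. cmod (poisson G (of_real (r n) * \<zeta>) - G \<zeta>)) \<in> borel_measurable circle_measure" for n
      by measurable
  qed auto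
  then have "\<forall>\<^sub>F n in sequentially. (LINT \<zeta>|circle_measure. cmod (poisson G (of_real (r n) * \<zeta>) - G \<zeta>)) < \<epsilon> / 3"
    using \<epsilon> by (intro order_tendstoD(2)) auto
  then have "\<forall>\<^sub>F n in sequentially. (LINT \<zeta>|circle_measure. cmod (poisson f (of_real (r n) * \<zeta>) - f \<zeta>)) < \<epsilon>"
  proof eventually_elim
    case (elim n)
    note Pf = poisson_dilate_L1[OF r(1) r(2) fi, of n]
    note PG = poisson_dilate_L1[OF r(1) r(2) Gi, of n]
    have di: "integrable circle_measure (\<lambda>\<zeta>. G \<zeta> - f \<zeta>)"
      using Gi fi by simp
    note PD = poisson_dilate_L1[OF r(1) r(2) di, of n]
    have "(LINT \<zeta>|circle_measure. cmod (poisson f (of_real (r n) * \<zeta>) - f \<zeta>))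
        \<le> (LINT \<zeta>|circle_measure. cmod (poisson (\<lambda>\<zeta>. G \<zeta> - f \<zeta>) (of_real (r n) * \<zeta>))
            + cmod (poisson G (of_real (r n) * \<zeta>) - G \<zeta>) + cmod (G \<zeta> - f \<zeta>))"
    proof (rule integral_mono_AE)
      show "AE \<zeta> in circle_measure. cmod (poisson f (of_real (r n) * \<zeta>) - f \<zeta>)
        \<le> cmod (poisson (\<lambda>\<zeta>. G \<zeta> - f \<zeta>) (of_real (r n) * \<zeta>))
            + cmod (poisson G (of_real (r n) * \<zeta>) - G \<zeta>) + cmod (G \<zeta> - f \<zeta>)"
      proof (rule AE_I2)
        fix \<zeta> assume "\<zeta> \<in> space circle_measure"
        then have \<zeta>: "cmod \<zeta> = 1" by simp
        have "poisson (\<lambda>\<zeta>. G \<zeta> - f \<zeta>) (of_real (r n) * \<zeta>)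
            = poisson G (of_real (r n) * \<zeta>) - poisson f (of_real (r n) * \<zeta>)"
          using lt[OF \<zeta>] Gi fi by (rule poisson_diff)
        then have "poisson f (of_real (r n) * \<zeta>) - f \<zeta> = - poisson (\<lambda>\<zeta>. G \<zeta> - f \<zeta>) (of_real (r n) * \<zeta>)
            + ((poisson G (of_real (r n) * \<zeta>) - G \<zeta>) + (G \<zeta> - f \<zeta>))"
          by simp
        then show "cmod (poisson f (of_real (r n) * \<zeta>) - f \<zeta>)
          \<le> cmod (poisson (\<lambda>\<zeta>. G \<zeta> - f \<zeta>) (of_real (r n) * \<zeta>))
            + cmod (poisson G (of_real (r n) * \<zeta>) - G \<zeta>) + cmod (G \<zeta> - f \<zeta>)"
          by (metis (no_types, lifting) add.assoc add_left_mono norm_minus_cancel norm_triangle_ineq order_trans)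
      qed
    qed (use Pf PG PD fi Gi in auto)
    also have "\<dots> = (LINT \<zeta>|circle_measure. cmod (poisson (\<lambda>\<zeta>. G \<zeta> - f \<zeta>) (of_real (r n) * \<zeta>)))
        + (LINT \<zeta>|circle_measure. cmod (poisson G (of_real (r n) * \<zeta>) - G \<zeta>))
        + (LINT \<zeta>|circle_measure. cmod (G \<zeta> - f \<zeta>))"
      using PG PD fi Gi by simp
    also have "\<dots> < \<epsilon>"
      using PD(2) elim Gf by linarith
    finally show ?case .
  qed
  then show "\<exists>N. \<forall>n\<ge>N. norm ((LINT \<zeta>|circle_measure. cmod (poisson f (of_real (r n) * \<zeta>) - f \<zeta>)) - 0) < \<epsilon>"
    by (simp add: eventually_sequentially)
qed

lemma Linf_boundedE:
  assumes "f \<in> Linf"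
  obtains M where "0 \<le> M" "AE \<zeta> in circle_measure. cmod (f \<zeta>) \<le> M"
proof -
  from assms have "Linf_norm f \<noteq> \<infinity>" by (auto simp: Linf_def)
  then obtain n :: nat where n: "Linf_norm f < ereal (real n)"
    using less_PInf_Ex_of_nat by blast
  have "AE \<zeta> in circle_measure. ereal (cmod (f \<zeta>)) \<le> Linf_norm f"
    unfolding Linf_norm_def by (rule esssup_AE)
  then have "AE \<zeta> in circle_measure. cmod (f \<zeta>) \<le> real n"
  proof eventually_elim
    case (elim \<zeta>)
    then have "ereal (cmod (f \<zeta>)) \<le> ereal (real n)" using n by (meson order.strict_implies_order order_trans)
    then show ?case by simp
  qed
  then show ?thesis by (intro that[of "real n"]) auto
qed

lemma LinfI:
  assumes "f \<in> borel_measurable circle_measure" "AE \<zeta> in circle_measure. cmod (f \<zeta>) \<le> M"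
  shows "f \<in> Linf"
proof -
  have "Linf_norm f \<le> ereal M"
    unfolding Linf_norm_def using assms by (intro esssup_I) auto
  then have "Linf_norm f < \<infinity>" by (rule le_less_trans) simp
  with assms show ?thesis by (simp add: Linf_def)
qed

lemma Linf_measurable: "f \<in> Linf \<Longrightarrow> f \<in> borel_measurable circle_measure"
  by (simp add: Linf_def)

lemma Linf_integrable:
  assumes "f \<in> Linf" shows "integrable circle_measure f"
proof -
  obtain M where "AE \<zeta> in circle_measure. cmod (f \<zeta>) \<le> M"
    using Linf_boundedE[OF assms] by blast
  then show ?thesis
    using Linf_measurable[OF assms] by (rule circle.integrable_const_bound)
qed

text \<open>This replaces Fatou's theorem on radial limits. A subsequence of radii is enough for passing
  from the disc to the circle, and it comes directly from convergence in \<open>L\<^sup>1\<close>.\<close>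

lemma poisson_dilate_AE_subseq:
  assumes f: "f \<in> Linf" and r: "\<And>n. 0 \<le> r n" "\<And>n. r n < 1" "r \<longlonglongrightarrow> 1"
  obtains s :: "nat \<Rightarrow> nat" where "strict_mono s"
    "AE \<zeta> in circle_measure. (\<lambda>n. poisson f (of_real (r (s n)) * \<zeta>)) \<longlonglongrightarrow> f \<zeta>"
proof -
  obtain M where M: "0 \<le> M" "AE \<zeta> in circle_measure. cmod (f \<zeta>) \<le> M"
    using Linf_boundedE[OF f] .
  have [measurable]: "f \<in> borel_measurable circle_measure" by (rule Linf_measurable[OF f])
  \<comment> \<open>The convergence in \<open>L\<^sup>1\<close> is available for functions bounded at every point, so the
    exceptional null set is cleared first; Poisson integrals do not notice.\<close>
  define g where "g \<zeta> = (if cmod (f \<zeta>) \<le> M then f \<zeta> else 0)" for \<zeta>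
  have gM: "cmod (g \<zeta>) \<le> M" for \<zeta> using M by (simp add: g_def)
  have [measurable]: "g \<in> borel_measurable circle_measure"
    unfolding g_def by measurable
  have gi: "integrable circle_measure g"
    using gM by (intro circle.integrable_const_bound[of _ M] AE_I2) auto
  have gf: "AE \<zeta> in circle_measure. f \<zeta> = g \<zeta>"
    using M(2) by eventually_elim (simp add: g_def)
  have P: "poisson f = poisson g"
    using poisson_cong_AE[OF gf] by auto
  obtain s where s: "strict_mono s"
    "AE \<zeta> in circle_measure. (\<lambda>n. poisson g (of_real (r (s n)) * \<zeta>) - g \<zeta>) \<longlonglongrightarrow> 0"
    using tendsto_L1_AE_subseq[of circle_measure "\<lambda>n \<zeta>. poisson g (of_real (r n) * \<zeta>) - g \<zeta>"]
      poisson_dilate_tendsto_L1[of g M r] poisson_dilate_L1(1)[OF r(1,2) gi] gi gM r by auto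
  from s(2) gf have "AE \<zeta> in circle_measure. (\<lambda>n. poisson f (of_real (r (s n)) * \<zeta>)) \<longlonglongrightarrow> f \<zeta>"
    by eventually_elim (simp add: P Lim_null[symmetric] LIM_zero_iff)
  with s(1) show ?thesis by (rule that)
qed

lemma radii_exist:
  obtains r :: "nat \<Rightarrow> real" where "\<And>n. 0 \<le> r n" "\<And>n. r n < 1" "r \<longlonglongrightarrow> 1"
proof (rule that[of "\<lambda>n. 1 - inverse (real (Suc n))"])
  show "(\<lambda>n. 1 - inverse (real (Suc n))) \<longlonglongrightarrow> 1"
    using tendsto_diff[OF tendsto_const LIMSEQ_inverse_real_of_nat, of 1] by simp
qed (auto simp: inverse_le_1_iff)

lemma AE_bounded_of_poisson_bounded:
  assumes f: "f \<in> Linf" and le: "\<And>z. cmod z < 1 \<Longrightarrow> cmod (poisson f z) \<le> M"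
  shows "AE \<zeta> in circle_measure. cmod (f \<zeta>) \<le> M"
proof -
  obtain r :: "nat \<Rightarrow> real" where r: "\<And>n. 0 \<le> r n" "\<And>n. r n < 1" "r \<longlonglongrightarrow> 1"
    using radii_exist by blast
  obtain s where "AE \<zeta> in circle_measure. (\<lambda>n. poisson f (of_real (r (s n)) * \<zeta>)) \<longlonglongrightarrow> f \<zeta>"
    using poisson_dilate_AE_subseq[OF f r] by blast
  then show ?thesis using AE_space
  proof eventually_elim
    case (elim \<zeta>)
    then have "(\<lambda>n. cmod (poisson f (of_real (r (s n)) * \<zeta>))) \<longlonglongrightarrow> cmod (f \<zeta>)"
      by (intro tendsto_norm)
    moreover have "cmod (poisson f (of_real (r (s n)) * \<zeta>)) \<le> M" for n
      using elim r(1,2)[of "s n"] by (intro le) (simp add: norm_mult)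
    ultimately show ?case by (auto intro: LIMSEQ_le_const2)
  qed
qed

section \<open>Products of bounded analytic functions\<close>

text \<open>The product of the two dilated extensions is continuous on the closed disc and analytic inside,
  hence equal to its own Poisson integral. Along a common subsequence of radii both factors converge almost
  everywhere to their boundary functions, and dominated convergence passes to the limit.\<close>

lemma poisson_mult:
  assumes f: "f \<in> Hinf" and h: "h \<in> Hinf" and z: "cmod z < 1"
  shows "poisson (\<lambda>\<zeta>. f \<zeta> * h \<zeta>) z = poisson f z * poisson h z"
proof -
  have fL: "f \<in> Linf" and hL: "h \<in> Linf"
    and fh: "poisson f holomorphic_on ball 0 1" and hh: "poisson h holomorphic_on ball 0 1"
    using f h by (auto simp: Hinf_def intro: analytic_imp_holomorphic)
  note fc = holomorphic_on_imp_continuous_on[OF fh] and hc = holomorphic_on_imp_continuous_on[OF hh]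
  have [measurable]: "f \<in> borel_measurable circle_measure" "h \<in> borel_measurable circle_measure"
    using fL hL by (auto intro: Linf_measurable)
  obtain M where M: "0 \<le> M" "AE \<zeta> in circle_measure. cmod (f \<zeta>) \<le> M"
    using Linf_boundedE[OF fL] .
  obtain L where L: "0 \<le> L" "AE \<zeta> in circle_measure. cmod (h \<zeta>) \<le> L"
    using Linf_boundedE[OF hL] .
  obtain r0 :: "nat \<Rightarrow> real" where r0: "\<And>n. 0 \<le> r0 n" "\<And>n. r0 n < 1" "r0 \<longlonglongrightarrow> 1"
    using radii_exist by blast
  obtain s where s: "strict_mono s"
    and sf: "AE \<zeta> in circle_measure. (\<lambda>n. poisson f (of_real (r0 (s n)) * \<zeta>)) \<longlonglongrightarrow> f \<zeta>"
    using poisson_dilate_AE_subseq[OF fL r0] .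
  have r1: "(\<lambda>n. r0 (s n)) \<longlonglongrightarrow> 1"
    using LIMSEQ_subseq_LIMSEQ[OF r0(3) s] by (simp add: o_def)
  obtain t where t: "strict_mono t"
    and th: "AE \<zeta> in circle_measure. (\<lambda>n. poisson h (of_real (r0 (s (t n))) * \<zeta>)) \<longlonglongrightarrow> h \<zeta>"
    using poisson_dilate_AE_subseq[OF hL, of "\<lambda>n. r0 (s n)"] r0(1,2) r1 by auto
  define r where "r n = r0 (s (t n))" for n
  have r: "0 \<le> r n" "r n < 1" "r \<longlonglongrightarrow> 1" for n
    using r0 LIMSEQ_subseq_LIMSEQ[OF r1 t] by (auto simp: r_def[abs_def] o_def)
  have lim: "AE \<zeta> in circle_measure. (\<lambda>n. poisson f (of_real (r n) * \<zeta>)) \<longlonglongrightarrow> f \<zeta>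
      \<and> (\<lambda>n. poisson h (of_real (r n) * \<zeta>)) \<longlonglongrightarrow> h \<zeta>"
    using sf th
  proof eventually_elim
    case (elim \<zeta>)
    then show ?case
      using LIMSEQ_subseq_LIMSEQ[OF elim(1) t] by (simp add: r_def o_def)
  qed
  have rlt: "cmod (of_real (r n) * \<zeta>) < 1" if "cmod \<zeta> \<le> 1" for n \<zeta>
  proof -
    have "r n * cmod \<zeta> \<le> r n * 1" using r(1) that by (intro mult_left_mono)
    then show ?thesis using r(1,2)[of n] by (simp add: norm_mult)
  qed
  define K where "K n \<zeta> = poisson f (of_real (r n) * \<zeta>) * poisson h (of_real (r n) * \<zeta>)" for n \<zeta>
  note [measurable] = poisson_dilate_measurable
  have [measurable]: "K n \<in> borel_measurable circle_measure" for n
    unfolding K_def by measurable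
  have "poisson (K n) z = K n z" for n
  proof (rule poisson_holomorphic[OF _ _ z])
    show "continuous_on (cball 0 1) (K n)"
      unfolding K_def using rlt
      by (intro continuous_intros continuous_on_compose2[OF fc] continuous_on_compose2[OF hc]) auto
    have img: "(\<lambda>\<zeta>::complex. of_real (r n) * \<zeta>) ` ball 0 1 \<subseteq> ball 0 1"
      using rlt by auto
    show "K n holomorphic_on ball 0 1"
      unfolding K_def
      using holomorphic_on_compose_gen[OF _ fh img] holomorphic_on_compose_gen[OF _ hh img]
      by (intro holomorphic_intros) (auto simp: o_def intro!: holomorphic_intros)
  qed
  moreover have "(\<lambda>n. K n z) \<longlonglongrightarrow> poisson f z * poisson h z"
  proof -
    have "(\<lambda>n. of_real (r n) * z) \<longlonglongrightarrow> of_real 1 * z"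
      by (intro tendsto_intros r)
    then have rz: "(\<lambda>n. of_real (r n) * z) \<longlonglongrightarrow> z" by simp
    have "isCont (poisson f) z" "isCont (poisson h) z"
      using fc hc z by (auto simp: continuous_on_eq_continuous_at)
    then show ?thesis
      unfolding K_def by (intro tendsto_mult isCont_tendsto_compose[OF _ rz])
  qed
  moreover have "(\<lambda>n. poisson (K n) z) \<longlonglongrightarrow> poisson (\<lambda>\<zeta>. f \<zeta> * h \<zeta>) z"
    unfolding poisson_eq
  proof (rule integral_dominated_convergence[where w = "\<lambda>\<zeta>. poisson_kernel z \<zeta> * (M * L)"])
    show "integrable circle_measure (\<lambda>\<zeta>. poisson_kernel z \<zeta> * (M * L))"
      using poisson_kernel_integrable[OF z] by simp
    show "AE \<zeta> in circle_measure. (\<lambda>n. poisson_kernel z \<zeta> *\<^sub>R K n \<zeta>) \<longlonglongrightarrow> poisson_kernel z \<zeta> *\<^sub>R (f \<zeta> * h \<zeta>)"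
      using lim unfolding K_def by eventually_elim (auto intro!: tendsto_intros)
    show "AE \<zeta> in circle_measure. norm (poisson_kernel z \<zeta> *\<^sub>R K n \<zeta>) \<le> poisson_kernel z \<zeta> * (M * L)" for n
    proof (rule AE_I2)
      fix \<zeta> assume "\<zeta> \<in> space circle_measure"
      then have \<zeta>: "cmod \<zeta> = 1" by simp
      have "cmod (K n \<zeta>) \<le> M * L"
        unfolding K_def norm_mult
        using \<zeta> rlt[of \<zeta> n] M L by (intro mult_mono norm_poisson_le_const) auto
      then show "norm (poisson_kernel z \<zeta> *\<^sub>R K n \<zeta>) \<le> poisson_kernel z \<zeta> * (M * L)"
        using poisson_kernel_pos[OF z \<zeta>] by (simp add: mult_left_mono)
    qed
  qed measurable
  ultimately show ?thesis
    using LIMSEQ_unique by force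
qed

section \<open>Blaschke products\<close>

lemma blaschke_identity:
  "(cmod (1 - cnj a * z))\<^sup>2 - (cmod (a - z))\<^sup>2 = (1 - (cmod a)\<^sup>2) * (1 - (cmod z)\<^sup>2)"
  unfolding cmod_power2 by (simp add: power2_eq_square algebra_simps)

lemma blaschke_denominator_nonzero:
  assumes "cmod a < 1" "cmod z \<le> 1" shows "1 - cnj a * z \<noteq> 0"
proof
  assume "1 - cnj a * z = 0"
  then have "1 = cmod (cnj a * z)" by simp
  also have "\<dots> \<le> cmod a * 1"
    unfolding norm_mult complex_mod_cnj using assms by (intro mult_left_mono) auto
  finally show False using assms by simp
qed

lemma cmod_blaschke_factor:
  "cmod (blaschke_factor a z) = cmod (a - z) / cmod (1 - cnj a * z)"
  by (auto simp: blaschke_factor_def norm_mult norm_divide)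

lemma blaschke_factor_le_1:
  assumes "cmod a < 1" "cmod z \<le> 1" shows "cmod (blaschke_factor a z) \<le> 1"
proof -
  have "0 \<le> (1 - (cmod a)\<^sup>2) * (1 - (cmod z)\<^sup>2)"
    using assms by (simp add: power_le_one)
  then have "(cmod (a - z))\<^sup>2 \<le> (cmod (1 - cnj a * z))\<^sup>2"
    using blaschke_identity[of a z] by linarith
  then have "cmod (a - z) \<le> cmod (1 - cnj a * z)"
    using power2_le_imp_le norm_ge_zero by blast
  then show ?thesis
    using blaschke_denominator_nonzero[OF assms] by (simp add: cmod_blaschke_factor)
qed

lemma blaschke_factor_unimodular:
  assumes "cmod a < 1" "cmod z = 1" shows "cmod (blaschke_factor a z) = 1"
proof -
  have "(cmod (a - z))\<^sup>2 = (cmod (1 - cnj a * z))\<^sup>2"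
    using blaschke_identity[of a z] assms by simp
  then have "cmod (a - z) = cmod (1 - cnj a * z)"
    by (simp add: power2_eq_iff_nonneg)
  then show ?thesis
    using blaschke_denominator_nonzero[of a z] assms by (simp add: cmod_blaschke_factor)
qed

lemma blaschke_factor_holomorphic:
  assumes "cmod a < 1" shows "blaschke_factor a holomorphic_on ball 0 1"
  unfolding blaschke_factor_def
  using blaschke_denominator_nonzero[OF assms] by (intro holomorphic_intros) auto

lemma blaschke_factor_continuous:
  assumes "cmod a < 1" shows "continuous_on (cball 0 1) (blaschke_factor a)"
  unfolding blaschke_factor_def
  using blaschke_denominator_nonzero[OF assms] by (intro continuous_intros) auto

lemma cmod_blaschke_factor_0: "cmod (blaschke_factor a 0) = cmod a"
  by (simp add: cmod_blaschke_factor)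

lemma blaschke_factor_self: "blaschke_factor a a = 0"
  by (simp add: blaschke_factor_def)

lemma blaschke_productE:
  assumes "blaschke_product B"
  obtains J :: "nat set" and a where "\<And>j. j \<in> J \<Longrightarrow> cmod (a j) < 1"
    "(\<lambda>j. 1 - cmod (a j)) summable_on J"
    "\<And>z. cmod z < 1 \<Longrightarrow> (\<lambda>j. if j \<in> J then blaschke_factor (a j) z else 1) has_prod poisson B z"
proof -
  from assms obtain J :: "nat set" and a where "\<forall>j\<in>J. a j \<in> ball 0 1"
    "(\<lambda>j. 1 - cmod (a j)) summable_on J"
    "\<forall>z\<in>ball 0 1. (\<lambda>j. if j \<in> J then blaschke_factor (a j) z else 1) has_prod poisson B z"
    unfolding blaschke_product_def blaschke_product_on_disc_def by blast
  then show ?thesis by (intro that[of J a]) auto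
qed

text \<open>It is enough that the mean of \<open>\<bar>B\<bar>\<close> on the circle is at least 1, since \<open>\<bar>B\<bar> \<le> 1\<close>. By the \<open>L\<^sup>1\<close>
  contraction this mean dominates the mean over each smaller circle of radius \<open>r\<close>, so it remains to make
  the latter close to 1. The factors from index \<open>N\<close> on form a function whose mean modulus on any
  circle about 0 is at least its modulus at 0, and that is at least 1 minus the tail from \<open>N\<close> of the Blaschke series. The
  finitely many factors before \<open>N\<close> are uniformly close to unimodular on a circle of
  radius near 1. Only finite partial products enter these estimates, so pointwise convergence of the
  infinite product inside the disc suffices for the last passage to the limit.\<close>

lemma blaschke_product_unimodular:
  assumes B: "blaschke_product B"
  shows "AE \<zeta> in circle_measure. cmod (B \<zeta>) = 1"
proof -
  from B have BL: "B \<in> Linf" by (simp add: blaschke_product_def Hinf_def)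
  have [measurable]: "B \<in> borel_measurable circle_measure" by (rule Linf_measurable[OF BL])
  from B obtain J a where a: "\<And>j. j \<in> J \<Longrightarrow> cmod (a j) < 1"
    and sum: "(\<lambda>j. 1 - cmod (a j)) summable_on J"
    and prod: "\<And>z. cmod z < 1 \<Longrightarrow> (\<lambda>j. if j \<in> J then blaschke_factor (a j) z else 1) has_prod poisson B z"
    using blaschke_productE[OF B] by blast
  define b where "b j z = (if j \<in> J then blaschke_factor (a j) z else 1)" for j z
  define t where "t j = (if j \<in> J then 1 - cmod (a j) else 0)" for j
  have t01: "t j \<in> {0..1}" for j
    using a[of j] by (auto simp: t_def less_imp_le)
  have b0: "cmod (b j 0) = 1 - t j" for j
    by (simp add: b_def t_def cmod_blaschke_factor_0)
  have b_le: "cmod (b j z) \<le> 1" if "cmod z \<le> 1" for j z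
    using that a by (simp add: b_def blaschke_factor_le_1)
  have b_uni: "cmod (b j z) = 1" if "cmod z = 1" for j z
    using that a by (simp add: b_def blaschke_factor_unimodular)
  have b_cont: "continuous_on (cball 0 1) (b j)" for j
    using a blaschke_factor_continuous[of "a j"] by (cases "j \<in> J") (simp_all add: b_def[abs_def])
  have b_hol: "b j holomorphic_on ball 0 1" for j
    using a blaschke_factor_holomorphic[of "a j"] by (cases "j \<in> J") (simp_all add: b_def[abs_def])
  define p where "p N m z = (\<Prod>j\<in>{N..<m}. b j z)" for N m z
  have p_le: "cmod (p N m z) \<le> 1" if "cmod z \<le> 1" for N m z
    unfolding p_def prod_norm[symmetric] using b_le[OF that] by (intro prod_le_1) auto
  have p_cont: "continuous_on (cball 0 1) (p N m)" for N m
    unfolding p_def by (intro continuous_intros b_cont)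
  have p_hol: "p N m holomorphic_on ball 0 1" for N m
    unfolding p_def by (intro holomorphic_intros b_hol)
  have p_lim: "(\<lambda>m. p 0 m z) \<longlonglongrightarrow> poisson B z" if "cmod z < 1" for z
    using has_prod_imp_tendsto'[OF prod[OF that]]
    by (simp add: p_def b_def atLeast0LessThan)
  have "summable t"
  proof -
    have "t summable_on UNIV \<longleftrightarrow> (\<lambda>j. 1 - cmod (a j)) summable_on J"
      by (rule summable_on_cong_neutral) (auto simp: t_def)
    then show ?thesis using sum summable_on_imp_summable by blast
  qed
  have BM: "AE \<zeta> in circle_measure. cmod (B \<zeta>) \<le> 1"
  proof (rule AE_bounded_of_poisson_bounded[OF BL])
    fix z :: complex assume z: "cmod z < 1"
    show "cmod (poisson B z) \<le> 1"
      using tendsto_norm[OF p_lim[OF z]] p_le z by (intro LIMSEQ_le_const2) auto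
  qed
  have Bi: "integrable circle_measure B" by (rule Linf_integrable[OF BL])
  have "1 \<le> (LINT \<zeta>|circle_measure. cmod (B \<zeta>))"
  proof (rule field_le_epsilon)
    fix \<epsilon> :: real assume \<epsilon>: "0 < \<epsilon>"
    \<comment> \<open>Two factors \<open>1 - e\<close> will be lost, one for the head and one for the tail of the product;
      they must be nonnegative to be multiplied.\<close>
    define e where "e = min (\<epsilon> / 2) 1"
    have e: "0 < e" "e \<le> 1" "2 * e \<le> \<epsilon>" using \<epsilon> by (auto simp: e_def)
    obtain N where N: "\<And>m. (\<Sum>j\<in>{N..<m}. t j) \<le> e"
    proof -
      from \<open>summable t\<close> e(1) obtain N where "\<And>m n. m \<ge> N \<Longrightarrow> norm (sum t {m..<n}) < e"
        unfolding summable_Cauchy by blast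
      then show ?thesis by (intro that[of N]) (metis abs_le_D1 less_imp_le order_refl real_norm_def)
    qed
    have "uniformly_continuous_on (cball 0 1) (p 0 N)"
      by (intro compact_uniformly_continuous p_cont) auto
    then obtain \<delta> where \<delta>: "0 < \<delta>" "\<And>x y. \<lbrakk>cmod x \<le> 1; cmod y \<le> 1; dist y x < \<delta>\<rbrakk> \<Longrightarrow> dist (p 0 N y) (p 0 N x) < e"
      using e(1) unfolding uniformly_continuous_on_def by (metis mem_cball_0)
    \<comment> \<open>The maximum with 0 keeps the radius nonnegative when \<open>\<delta>\<close> is large.\<close>
    define r where "r = max 0 (1 - \<delta> / 2)"
    have r: "0 \<le> r" "r < 1" "1 - r < \<delta>" using \<delta>(1) by (auto simp: r_def)
    have rlt: "cmod (of_real r * \<zeta>) < 1" if "cmod \<zeta> \<le> 1" for \<zeta>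
    proof -
      have "r * cmod \<zeta> \<le> r * 1" using r(1) that by (intro mult_left_mono)
      then show ?thesis using r(1,2) by (simp add: norm_mult)
    qed
    have head: "1 - e \<le> cmod (p 0 N (of_real r * \<zeta>))" if \<zeta>: "cmod \<zeta> = 1" for \<zeta>
    proof -
      have "of_real r * \<zeta> - \<zeta> = - (of_real (1 - r) * \<zeta>)" by (simp add: algebra_simps)
      then have "dist (of_real r * \<zeta>) \<zeta> = 1 - r"
        using r \<zeta> by (simp add: dist_norm norm_mult del: of_real_diff)
      then have "cmod (p 0 N (of_real r * \<zeta>) - p 0 N \<zeta>) < e"
        using \<delta>(2)[of \<zeta> "of_real r * \<zeta>"] rlt[of \<zeta>] \<zeta> r by (simp add: dist_norm)
      moreover have "cmod (p 0 N \<zeta>) = 1"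
        unfolding p_def prod_norm[symmetric] using b_uni[OF \<zeta>] by simp
      ultimately show ?thesis
        using norm_triangle_ineq2[of "p 0 N \<zeta>" "p 0 N (of_real r * \<zeta>)"] by (simp add: norm_minus_commute)
    qed
    have dil_cont: "continuous_on (cball 0 1) (\<lambda>\<zeta>. p n m (of_real r * \<zeta>))" for n m
      using rlt by (intro continuous_on_compose2[OF p_cont] continuous_intros) (auto simp: less_imp_le)
    have dil_meas [measurable]: "(\<lambda>\<zeta>. p n m (of_real r * \<zeta>)) \<in> borel_measurable circle_measure" for n m
      unfolding borel_measurable_circle_iff
      by (intro borel_measurable_continuous_on_restrict continuous_on_subset[OF dil_cont]) auto
    have dil_int: "integrable circle_measure (\<lambda>\<zeta>. p n m (of_real r * \<zeta>))" for n m
      using rlt p_le by (intro circle.integrable_const_bound[of _ 1] AE_I2) (auto simp: less_imp_le)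
    \<comment> \<open>The mean value property at 0, for the dilated partial product, and Weierstrass's
      inequality for finite products.\<close>
    have tail: "1 - e \<le> (LINT \<zeta>|circle_measure. cmod (p N m (of_real r * \<zeta>)))" for m
    proof -
      have "1 - e \<le> 1 - sum t {N..<m}" using N[of m] by simp
      also have "\<dots> \<le> (\<Prod>j\<in>{N..<m}. 1 - t j)" by (intro Weierstrass_prod_ineq t01)
      also have "\<dots> = cmod (p N m 0)" by (simp add: p_def b0 flip: prod_norm)
      also have "p N m 0 = poisson (\<lambda>\<zeta>. p N m (of_real r * \<zeta>)) 0"
      proof -
        have img: "(\<lambda>\<zeta>::complex. of_real r * \<zeta>) ` ball 0 1 \<subseteq> ball 0 1"
          using rlt by auto
        have "(\<lambda>\<zeta>. p N m (of_real r * \<zeta>)) holomorphic_on ball 0 1"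
          using holomorphic_on_compose_gen[OF _ p_hol img] by (auto simp: o_def intro!: holomorphic_intros)
        from poisson_holomorphic[OF dil_cont this, of 0] show ?thesis by simp
      qed
      also have "cmod \<dots> \<le> poisson (\<lambda>\<zeta>. cmod (p N m (of_real r * \<zeta>))) 0"
        by (rule norm_poisson_le) simp
      also have "\<dots> = (LINT \<zeta>|circle_measure. cmod (p N m (of_real r * \<zeta>)))"
        unfolding poisson_eq by (rule Bochner_Integration.integral_cong) (auto simp: poisson_kernel_def)
      finally show ?thesis .
    qed
    have partial: "(1 - e) * (1 - e) \<le> (LINT \<zeta>|circle_measure. cmod (p 0 m (of_real r * \<zeta>)))" if "N \<le> m" for m
    proof -
      have "(1 - e) * (1 - e) \<le> (1 - e) * (LINT \<zeta>|circle_measure. cmod (p N m (of_real r * \<zeta>)))"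
        using tail e by (intro mult_left_mono) auto
      also have "\<dots> = (LINT \<zeta>|circle_measure. (1 - e) * cmod (p N m (of_real r * \<zeta>)))"
        by simp
      also have "\<dots> \<le> (LINT \<zeta>|circle_measure. cmod (p 0 m (of_real r * \<zeta>)))"
      proof (rule integral_mono_AE)
        show "AE \<zeta> in circle_measure. (1 - e) * cmod (p N m (of_real r * \<zeta>)) \<le> cmod (p 0 m (of_real r * \<zeta>))"
        proof (rule AE_I2)
          fix \<zeta> assume "\<zeta> \<in> space circle_measure"
          then have \<zeta>: "cmod \<zeta> = 1" by simp
          have "p 0 m (of_real r * \<zeta>) = p 0 N (of_real r * \<zeta>) * p N m (of_real r * \<zeta>)"
            unfolding p_def using that by (simp add: prod.atLeastLessThan_concat)
          then show "(1 - e) * cmod (p N m (of_real r * \<zeta>)) \<le> cmod (p 0 m (of_real r * \<zeta>))"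
            using head[OF \<zeta>] by (simp add: norm_mult mult_right_mono)
        qed
      qed (use dil_int in auto)
      finally show ?thesis .
    qed
    have "(\<lambda>m. LINT \<zeta>|circle_measure. cmod (p 0 m (of_real r * \<zeta>)))
        \<longlonglongrightarrow> (LINT \<zeta>|circle_measure. cmod (poisson B (of_real r * \<zeta>)))"
    proof (rule integral_dominated_convergence[where w = "\<lambda>_. 1"])
      show "AE \<zeta> in circle_measure. (\<lambda>m. cmod (p 0 m (of_real r * \<zeta>))) \<longlonglongrightarrow> cmod (poisson B (of_real r * \<zeta>))"
        using rlt by (intro AE_I2 tendsto_norm p_lim) auto
      show "AE \<zeta> in circle_measure. norm (cmod (p 0 m (of_real r * \<zeta>))) \<le> 1" for m
        using rlt p_le by (intro AE_I2) (auto simp: less_imp_le)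
      show "(\<lambda>\<zeta>. cmod (poisson B (of_real r * \<zeta>))) \<in> borel_measurable circle_measure"
        using poisson_dilate_measurable[of B r] by measurable
    qed auto
    then have "(1 - e) * (1 - e) \<le> (LINT \<zeta>|circle_measure. cmod (poisson B (of_real r * \<zeta>)))"
      using partial by (intro LIMSEQ_le_const) auto
    also have "\<dots> \<le> (LINT \<zeta>|circle_measure. cmod (B \<zeta>))"
      by (rule poisson_dilate_L1(2)[OF r(1,2) Bi])
    finally have "1 - 2 * e + e * e \<le> (LINT \<zeta>|circle_measure. cmod (B \<zeta>))"
      by (simp add: algebra_simps)
    then show "1 \<le> (LINT \<zeta>|circle_measure. cmod (B \<zeta>)) + \<epsilon>"
      using e zero_le_square[of e] by linarith
  qed
  then have "(LINT \<zeta>|circle_measure. 1 - cmod (B \<zeta>)) \<le> 0"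
    using Bi circle.prob_space by simp
  moreover have "0 \<le> (LINT \<zeta>|circle_measure. 1 - cmod (B \<zeta>))"
    using BM by (intro integral_nonneg_AE) auto
  ultimately have "(LINT \<zeta>|circle_measure. 1 - cmod (B \<zeta>)) = 0" by simp
  then have "AE \<zeta> in circle_measure. 1 - cmod (B \<zeta>) = 0"
    using BM Bi by (subst (asm) integral_nonneg_eq_0_iff_AE) auto
  then show ?thesis by eventually_elim simp
qed

text \<open>The empty product is constant, so there is at least one factor. It vanishes at its own zero, where
  all later partial products vanish as well.\<close>

lemma blaschke_product_has_zero:
  assumes B: "blaschke_product B" and nc: "\<not> poisson B constant_on ball 0 1"
  obtains a where "cmod a < 1" "poisson B a = 0"
proof -
  obtain J a where a: "\<And>j. j \<in> J \<Longrightarrow> cmod (a j) < 1"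
    and "(\<lambda>j. 1 - cmod (a j)) summable_on J"
    and prod: "\<And>z. cmod z < 1 \<Longrightarrow> (\<lambda>j. if j \<in> J then blaschke_factor (a j) z else 1) has_prod poisson B z"
    using blaschke_productE[OF B] by blast
  have "J \<noteq> {}"
  proof
    assume "J = {}"
    have "poisson B z = 1" if "cmod z < 1" for z
    proof -
      have "(\<lambda>n. \<Prod>k<n. (1::complex)) \<longlonglongrightarrow> poisson B z"
        using has_prod_imp_tendsto'[OF prod[OF that]] \<open>J = {}\<close> by simp
      then show ?thesis by (simp add: LIMSEQ_const_iff)
    qed
    then have "poisson B constant_on ball 0 1"
      unfolding constant_on_def by auto
    with nc show False ..
  qed
  then obtain j where j: "j \<in> J" by auto
  define f where "f k = (if k \<in> J then blaschke_factor (a k) (a j) else 1)" for k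
  have "(\<lambda>n. \<Prod>k<n. f k) \<longlonglongrightarrow> poisson B (a j)"
    using has_prod_imp_tendsto'[OF prod[OF a[OF j]]] by (simp add: f_def)
  moreover have "(\<lambda>n. \<Prod>k<n. f k) \<longlonglongrightarrow> 0"
  proof (rule tendsto_eventually)
    show "\<forall>\<^sub>F n in sequentially. (\<Prod>k<n. f k) = 0"
      using eventually_gt_at_top[of j]
    proof eventually_elim
      case (elim n)
      have "f j = 0" using j by (simp add: f_def blaschke_factor_self)
      with elim show ?case by (intro prod_zero bexI[of _ j]) auto
    qed
  qed
  ultimately have "poisson B (a j) = 0" by (rule LIMSEQ_unique)
  with a[OF j] show ?thesis by (rule that)
qed

lemma poisson_id: "cmod z < 1 \<Longrightarrow> poisson (\<lambda>\<zeta>. \<zeta>) z = z"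
  by (rule poisson_holomorphic) (simp_all add: holomorphic_on_ident)

text \<open>With the single zero 0 the normalising constant is \<open>-1\<close>, and the factor becomes \<open>- (0 - z) = z\<close>.\<close>

lemma blaschke_product_id: "blaschke_product (\<lambda>\<zeta>. \<zeta>)"
  unfolding blaschke_product_def
proof
  have "(\<lambda>\<zeta>. \<zeta>) \<in> Linf"
    by (rule LinfI[of _ 1]) (auto intro: AE_I2)
  moreover have "poisson (\<lambda>\<zeta>. \<zeta>) holomorphic_on ball 0 1"
    using holomorphic_cong[of "ball 0 1" "ball 0 1" "poisson (\<lambda>\<zeta>. \<zeta>)" "\<lambda>z. z"]
    by (simp add: poisson_id)
  ultimately show "(\<lambda>\<zeta>. \<zeta>) \<in> Hinf"
    by (simp add: Hinf_def analytic_on_open)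
  have *: "(\<lambda>j::nat. if j \<in> {0} then blaschke_factor 0 z else 1) has_prod z" for z
    using has_prod_finite[of "{0::nat}" "\<lambda>j. if j \<in> {0} then blaschke_factor 0 z else 1"]
    by (simp add: blaschke_factor_def)
  show "blaschke_product_on_disc (poisson (\<lambda>\<zeta>. \<zeta>))"
    unfolding blaschke_product_on_disc_def
    by (intro exI[of _ "{0}"] exI[of _ "\<lambda>_. 0"] conjI) (use * in \<open>simp_all add: poisson_id\<close>)
qed

lemma poisson_id_not_constant: "\<not> poisson (\<lambda>\<zeta>. \<zeta>) constant_on ball 0 1"
proof
  assume "poisson (\<lambda>\<zeta>. \<zeta>) constant_on ball 0 1"
  then obtain c where c: "\<And>z. z \<in> ball 0 1 \<Longrightarrow> poisson (\<lambda>\<zeta>. \<zeta>) z = c"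
    unfolding constant_on_def by blast
  have "(0::complex) = 1 / 2"
    using c[of 0] c[of "1 / 2"] by (simp add: poisson_id norm_divide)
  then show False by simp
qed

section \<open>The Garsia norm\<close>

lemma L2_integrable:
  assumes "f \<in> L2"
  shows "integrable circle_measure f" and "integrable circle_measure (\<lambda>\<zeta>. (cmod (f \<zeta> - c))\<^sup>2)"
proof -
  from assms have [measurable]: "f \<in> borel_measurable circle_measure"
    and sq: "integrable circle_measure (\<lambda>\<zeta>. (cmod (f \<zeta>))\<^sup>2)"
    by (auto simp: L2_def)
  show "integrable circle_measure f"
  proof (rule Bochner_Integration.integrable_bound)
    show "integrable circle_measure (\<lambda>\<zeta>. 1 + (cmod (f \<zeta>))\<^sup>2)" using sq by simp
    have "x \<le> 1 + x\<^sup>2" for x :: real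
    proof -
      have "(x - 1)\<^sup>2 = x\<^sup>2 - 2 * x + 1" by (simp add: power2_eq_square algebra_simps)
      then show ?thesis using zero_le_power2[of "x - 1"] zero_le_power2[of x] by linarith
    qed
    then show "AE \<zeta> in circle_measure. norm (f \<zeta>) \<le> norm (1 + (cmod (f \<zeta>))\<^sup>2)"
      by (intro AE_I2) simp
  qed measurable
  show "integrable circle_measure (\<lambda>\<zeta>. (cmod (f \<zeta> - c))\<^sup>2)"
  proof (rule Bochner_Integration.integrable_bound)
    show "integrable circle_measure (\<lambda>\<zeta>. 2 * (cmod (f \<zeta>))\<^sup>2 + 2 * (cmod c)\<^sup>2)" using sq by simp
    have "(cmod (w - c))\<^sup>2 \<le> 2 * (cmod w)\<^sup>2 + 2 * (cmod c)\<^sup>2" for w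
    proof -
      have "(cmod (w - c))\<^sup>2 \<le> (cmod w + cmod c)\<^sup>2"
        by (intro power_mono norm_triangle_ineq4) auto
      also have "\<dots> \<le> 2 * (cmod w)\<^sup>2 + 2 * (cmod c)\<^sup>2"
        using zero_le_power2[of "cmod w - cmod c"] by (simp add: power2_eq_square algebra_simps)
      finally show ?thesis .
    qed
    then show "AE \<zeta> in circle_measure. norm ((cmod (f \<zeta> - c))\<^sup>2) \<le> norm (2 * (cmod (f \<zeta>))\<^sup>2 + 2 * (cmod c)\<^sup>2)"
      by (intro AE_I2) simp
  qed measurable
qed

lemma cmod_diff_squared:
  "(cmod (w - c))\<^sup>2 = (cmod w)\<^sup>2 - 2 * Re (cnj c * w) + (cmod c)\<^sup>2"
  unfolding cmod_power2 by (simp add: power2_eq_square algebra_simps)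

lemma poisson_Re_mult:
  assumes "cmod z < 1" "integrable circle_measure f"
  shows "poisson (\<lambda>\<zeta>. Re (c * f \<zeta>)) z = Re (c * poisson f z)"
proof -
  have "poisson (\<lambda>\<zeta>. Re (c * f \<zeta>)) z = (LINT \<zeta>|circle_measure. Re (c * (poisson_kernel z \<zeta> *\<^sub>R f \<zeta>)))"
    unfolding poisson_eq by (rule Bochner_Integration.integral_cong) (auto simp: algebra_simps)
  also have "\<dots> = Re (LINT \<zeta>|circle_measure. c * (poisson_kernel z \<zeta> *\<^sub>R f \<zeta>))"
    using poisson_integrable[OF assms] by (intro integral_Re integrable_mult_right)
  also have "\<dots> = Re (c * poisson f z)"
    unfolding poisson_eq by (simp only: integral_mult_right_zero)
  finally show ?thesis .
qed

lemma poisson_mult_const: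
  fixes f :: "complex \<Rightarrow> real"
  shows "poisson (\<lambda>\<zeta>. c * f \<zeta>) z = c * poisson f z"
proof -
  have "poisson_kernel z \<zeta> *\<^sub>R (c * f \<zeta>) = c * (poisson_kernel z \<zeta> *\<^sub>R f \<zeta>)" for \<zeta>
    by simp
  then show ?thesis unfolding poisson_eq by (simp only: integral_mult_right_zero)
qed

text \<open>\<open>\<Phi>\<^sub>f(z)\<close> is the variance of \<open>f\<close> with respect to the probability measure that has the
  Poisson kernel at \<open>z\<close> as its density, and this is the decomposition of the mean square
  deviation from an arbitrary constant.\<close>

lemma poisson_square_deviation:
  assumes f: "f \<in> L2" and z: "cmod z < 1"
  shows "poisson (\<lambda>\<zeta>. (cmod (f \<zeta> - c))\<^sup>2) z = Phi f z + (cmod (poisson f z - c))\<^sup>2"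
proof -
  have fi: "integrable circle_measure f" using L2_integrable[OF f] by simp
  have sq: "integrable circle_measure (\<lambda>\<zeta>. (cmod (f \<zeta>))\<^sup>2)"
    using f by (simp add: L2_def)
  have ri: "integrable circle_measure (\<lambda>\<zeta>. Re (2 * cnj c * f \<zeta>))"
    using fi by (intro integrable_Re integrable_mult_right)
  have "poisson (\<lambda>\<zeta>. (cmod (f \<zeta> - c))\<^sup>2) z
      = poisson (\<lambda>\<zeta>. (cmod (f \<zeta>))\<^sup>2 - Re (2 * cnj c * f \<zeta>) + (cmod c)\<^sup>2) z"
    by (simp add: cmod_diff_squared mult.assoc)
  also have "\<dots> = poisson (\<lambda>\<zeta>. (cmod (f \<zeta>))\<^sup>2 - Re (2 * cnj c * f \<zeta>)) z + (cmod c)\<^sup>2"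
    using z sq ri by (subst poisson_add) auto
  also have "poisson (\<lambda>\<zeta>. (cmod (f \<zeta>))\<^sup>2 - Re (2 * cnj c * f \<zeta>)) z
      = poisson (\<lambda>\<zeta>. (cmod (f \<zeta>))\<^sup>2) z - poisson (\<lambda>\<zeta>. Re (2 * cnj c * f \<zeta>)) z"
    using z sq ri by (rule poisson_diff)
  also have "poisson (\<lambda>\<zeta>. Re (2 * cnj c * f \<zeta>)) z = Re (2 * cnj c * poisson f z)"
    using z fi by (rule poisson_Re_mult)
  finally show ?thesis
    by (simp add: Phi_def cmod_diff_squared mult.assoc)
qed

lemma ball_BMO_Phi_le:
  assumes "u \<in> ball_BMO" "cmod z < 1" shows "Phi u z \<le> 1"
proof -
  have "ereal (sqrt (Phi u z)) \<le> garsia_norm u"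
    unfolding garsia_norm_def using assms(2) by (intro SUP_upper) auto
  also have "\<dots> \<le> ereal 1" using assms(1) by (simp add: ball_BMO_def one_ereal_def)
  finally show ?thesis by simp
qed

lemma bounded_L2:
  assumes [measurable]: "f \<in> borel_measurable circle_measure" and le: "AE \<zeta> in circle_measure. cmod (f \<zeta>) \<le> 1"
  shows "f \<in> L2"
proof -
  have "AE \<zeta> in circle_measure. norm ((cmod (f \<zeta>))\<^sup>2) \<le> 1"
    using le by eventually_elim (simp add: power_le_one)
  then show ?thesis
    unfolding L2_def by (auto intro: circle.integrable_const_bound[of _ 1])
qed

lemma bounded_in_ball_BMO:
  assumes [measurable]: "f \<in> borel_measurable circle_measure" and le: "AE \<zeta> in circle_measure. cmod (f \<zeta>) \<le> 1"
  shows "f \<in> ball_BMO"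
proof -
  have f2: "f \<in> L2" using assms by (rule bounded_L2)
  have "Phi f z \<le> 1" if z: "cmod z < 1" for z
  proof -
    have "poisson (\<lambda>\<zeta>. (cmod (f \<zeta>))\<^sup>2) z \<le> poisson (\<lambda>\<zeta>. 1) z"
    proof (rule poisson_mono_AE[OF z])
      show "AE \<zeta> in circle_measure. (cmod (f \<zeta>))\<^sup>2 \<le> 1"
        using le by eventually_elim (simp add: power_le_one)
    qed (use f2 in \<open>auto simp: L2_def\<close>)
    then have "poisson (\<lambda>\<zeta>. (cmod (f \<zeta>))\<^sup>2) z \<le> 1" using z by simp
    then show ?thesis
      unfolding Phi_def using zero_le_power2[of "cmod (poisson f z)"] by linarith
  qed
  then have "garsia_norm f \<le> 1"
    unfolding garsia_norm_def by (intro SUP_least) (simp add: one_ereal_def)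
  moreover from this have "garsia_norm f < \<infinity>" by (rule le_less_trans) simp
  ultimately show ?thesis using f2 by (simp add: ball_BMO_def BMO_def)
qed

section \<open>Extreme points of the unit ball of BMO\<close>

text \<open>At a zero \<open>a\<close> of the extension the variance of a unimodular function attains its largest possible
  value 1. Suppose that \<open>f\<close> is the midpoint of \<open>u\<close> and \<open>v\<close> up to a constant, and let \<open>p\<close>, \<open>q\<close> be the means
  of \<open>u\<close>, \<open>v\<close> with respect to the Poisson kernel at \<open>a\<close>. By the parallelogram law the mean of
  \<open>\<bar>(u - p) - (v - q)\<bar>\<^sup>2\<close> is twice the sum of the variances of \<open>u\<close> and \<open>v\<close>, at most 4, minus four times a
  mean square deviation of \<open>f\<close>, at least 4. So it is 0. Since the Poisson kernel is
  strictly positive, \<open>u\<close> and \<open>v\<close> differ by a constant.\<close>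

lemma unimodular_extreme:
  assumes [measurable]: "f \<in> borel_measurable circle_measure" and uni: "AE \<zeta> in circle_measure. cmod (f \<zeta>) = 1"
    and a: "cmod a < 1" and zero: "poisson f a = 0"
  shows "extreme_point_ball_BMO f"
  unfolding extreme_point_ball_BMO_def
proof (intro conjI notI)
  have le: "AE \<zeta> in circle_measure. cmod (f \<zeta>) \<le> 1"
    using uni by eventually_elim simp
  then show "f \<in> ball_BMO" by (intro bounded_in_ball_BMO) auto
  have f2: "f \<in> L2" using le by (intro bounded_L2) auto
  assume "\<exists>u\<in>ball_BMO. \<exists>v\<in>ball_BMO. \<not> bmo_eq u v \<and> bmo_eq f (\<lambda>\<zeta>. (u \<zeta> + v \<zeta>) / 2)"
  then obtain u v c where u: "u \<in> ball_BMO" and v: "v \<in> ball_BMO" and ne: "\<not> bmo_eq u v"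
    and mid: "AE \<zeta> in circle_measure. f \<zeta> = (u \<zeta> + v \<zeta>) / 2 + c"
    unfolding bmo_eq_def by blast
  have u2: "u \<in> L2" and v2: "v \<in> L2"
    using u v by (auto simp: ball_BMO_def BMO_def)
  then have [measurable]: "u \<in> borel_measurable circle_measure" "v \<in> borel_measurable circle_measure"
    by (auto simp: L2_def)
  define p where "p = poisson u a"
  define q where "q = poisson v a"
  define d where "d = (p + q) / 2 + c"
  define D where "D \<zeta> = (cmod (u \<zeta> - p - (v \<zeta> - q)))\<^sup>2" for \<zeta>
  let ?S = "\<lambda>\<zeta>. (cmod (u \<zeta> - p))\<^sup>2 + (cmod (v \<zeta> - q))\<^sup>2"
  let ?T = "\<lambda>\<zeta>. (cmod (f \<zeta> - d))\<^sup>2"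
  have iu: "integrable circle_measure (\<lambda>\<zeta>. (cmod (u \<zeta> - p))\<^sup>2)"
    and iv: "integrable circle_measure (\<lambda>\<zeta>. (cmod (v \<zeta> - q))\<^sup>2)"
    and "integrable circle_measure ?T"
    using L2_integrable u2 v2 f2 by blast+
  then have iS: "integrable circle_measure (\<lambda>\<zeta>. 2 * ?S \<zeta>)"
    and iT: "integrable circle_measure (\<lambda>\<zeta>. 4 * ?T \<zeta>)"
    by (auto simp del: distrib_left_numeral)
  have [measurable]: "D \<in> borel_measurable circle_measure"
    unfolding D_def by measurable
  have D: "AE \<zeta> in circle_measure. D \<zeta> = 2 * ?S \<zeta> - 4 * ?T \<zeta>"
    using mid
  proof eventually_elim
    case (elim \<zeta>)
    have "u \<zeta> - p + (v \<zeta> - q) = 2 * (f \<zeta> - d)"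
      unfolding elim d_def by (simp add: field_simps)
    then have "4 * ?T \<zeta> = (cmod (u \<zeta> - p + (v \<zeta> - q)))\<^sup>2"
      by (simp only: norm_mult power_mult_distrib) simp
    moreover have "(cmod (x - y))\<^sup>2 + (cmod (x + y))\<^sup>2 = 2 * ((cmod x)\<^sup>2 + (cmod y)\<^sup>2)" for x y
      unfolding cmod_power2 by (simp add: power2_eq_square algebra_simps)
    ultimately show ?case
      by (simp add: D_def eq_diff_eq)
  qed
  have Di: "integrable circle_measure D"
  proof (rule integrable_cong_AE_imp)
    show "integrable circle_measure (\<lambda>\<zeta>. 2 * ?S \<zeta> - 4 * ?T \<zeta>)"
      by (rule Bochner_Integration.integrable_diff[OF iS iT])
    show "AE \<zeta> in circle_measure. 2 * ?S \<zeta> - 4 * ?T \<zeta> = D \<zeta>"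
      using D by eventually_elim simp
  qed measurable
  have fT: "poisson ?T a \<ge> 1"
  proof -
    have "poisson (\<lambda>\<zeta>. (cmod (f \<zeta>))\<^sup>2) a = poisson (\<lambda>\<zeta>. 1::real) a"
      using uni by (intro poisson_cong_AE) auto
    then have "Phi f a = 1" using zero a by (simp add: Phi_def)
    then show ?thesis using poisson_square_deviation[OF f2 a, of d] by simp
  qed
  have "poisson ?S a = poisson (\<lambda>\<zeta>. (cmod (u \<zeta> - p))\<^sup>2) a + poisson (\<lambda>\<zeta>. (cmod (v \<zeta> - q))\<^sup>2) a"
    by (rule poisson_add[OF a iu iv])
  also have "\<dots> = Phi u a + Phi v a"
    using poisson_square_deviation[OF u2 a, of p] poisson_square_deviation[OF v2 a, of q]
    by (simp add: p_def q_def)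
  also have "\<dots> \<le> 2"
    using ball_BMO_Phi_le[OF u a] ball_BMO_Phi_le[OF v a] by simp
  finally have S: "poisson ?S a \<le> 2" .
  have "poisson D a = poisson (\<lambda>\<zeta>. 2 * ?S \<zeta> - 4 * ?T \<zeta>) a"
    using D by (rule poisson_cong_AE) measurable
  also have "\<dots> = poisson (\<lambda>\<zeta>. 2 * ?S \<zeta>) a - poisson (\<lambda>\<zeta>. 4 * ?T \<zeta>) a"
    by (rule poisson_diff[OF a iS iT])
  also have "\<dots> = 2 * poisson ?S a - 4 * poisson ?T a"
    by (simp only: poisson_mult_const)
  finally have "poisson D a \<le> 0" using S fT by simp
  moreover have pos: "AE \<zeta> in circle_measure. 0 \<le> poisson_kernel a \<zeta> * D \<zeta>"
    using poisson_kernel_pos[OF a] by (intro AE_I2) (auto simp: D_def less_imp_le)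
  ultimately have "(LINT \<zeta>|circle_measure. poisson_kernel a \<zeta> * D \<zeta>) = 0"
    using integral_nonneg_AE[OF pos] by (simp add: poisson_eq)
  then have "AE \<zeta> in circle_measure. poisson_kernel a \<zeta> * D \<zeta> = 0"
    using integral_nonneg_eq_0_iff_AE[OF _ pos] poisson_integrable[OF a Di] by simp
  then have "AE \<zeta> in circle_measure. u \<zeta> = v \<zeta> + (p - q)"
    using AE_space
  proof eventually_elim
    case (elim \<zeta>)
    then have "D \<zeta> = 0" using poisson_kernel_pos[OF a, of \<zeta>] by auto
    then show ?case by (simp add: D_def algebra_simps)
  qed
  then have "bmo_eq u v" unfolding bmo_eq_def by blast
  with ne show False ..
qed

text \<open>The slack \<open>1 - \<bar>f\<bar>\<close>, multiplied by a unimodular function, can be added to and subtracted from \<open>f\<close>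
  without leaving the unit ball of \<open>L\<^sup>\<infinity>\<close>, hence without leaving the unit ball of BMO. If \<open>f\<close>
  is extreme, this perturbation must vanish in BMO.\<close>

lemma extreme_perturbation_constant:
  assumes [measurable]: "f \<in> borel_measurable circle_measure" "k \<in> borel_measurable circle_measure"
    and le: "AE \<zeta> in circle_measure. cmod (f \<zeta>) \<le> 1"
    and k: "\<And>\<zeta>. cmod \<zeta> = 1 \<Longrightarrow> cmod (k \<zeta>) = 1"
    and ext: "extreme_point_ball_BMO f"
  obtains c where "AE \<zeta> in circle_measure. of_real (1 - cmod (f \<zeta>)) * k \<zeta> = c"
proof -
  define g where "g \<zeta> = of_real (1 - cmod (f \<zeta>)) * k \<zeta>" for \<zeta>
  have [measurable]: "g \<in> borel_measurable circle_measure" unfolding g_def by measurable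
  have g: "AE \<zeta> in circle_measure. cmod (f \<zeta>) + cmod (g \<zeta>) \<le> 1"
    using le AE_space
  proof eventually_elim
    case (elim \<zeta>)
    then show ?case using k[of \<zeta>] by (simp add: g_def norm_mult del: of_real_diff)
  qed
  have "(\<lambda>\<zeta>. f \<zeta> + g \<zeta>) \<in> ball_BMO"
  proof (rule bounded_in_ball_BMO)
    show "AE \<zeta> in circle_measure. cmod (f \<zeta> + g \<zeta>) \<le> 1"
      using g by eventually_elim (meson norm_triangle_ineq order_trans)
  qed measurable
  moreover have "(\<lambda>\<zeta>. f \<zeta> - g \<zeta>) \<in> ball_BMO"
  proof (rule bounded_in_ball_BMO)
    show "AE \<zeta> in circle_measure. cmod (f \<zeta> - g \<zeta>) \<le> 1"
      using g by eventually_elim (meson norm_triangle_ineq4 order_trans)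
  qed measurable
  moreover have "bmo_eq f (\<lambda>\<zeta>. ((f \<zeta> + g \<zeta>) + (f \<zeta> - g \<zeta>)) / 2)"
    unfolding bmo_eq_def by (intro exI[of _ 0] AE_I2) simp
  ultimately have "bmo_eq (\<lambda>\<zeta>. f \<zeta> + g \<zeta>) (\<lambda>\<zeta>. f \<zeta> - g \<zeta>)"
    using ext unfolding extreme_point_ball_BMO_def by blast
  then obtain c where "AE \<zeta> in circle_measure. f \<zeta> + g \<zeta> = f \<zeta> - g \<zeta> + c"
    unfolding bmo_eq_def by blast
  then have "AE \<zeta> in circle_measure. g \<zeta> = c / 2"
  proof eventually_elim
    case (elim \<zeta>)
    have "2 * g \<zeta> = (f \<zeta> + g \<zeta>) - (f \<zeta> - g \<zeta>)" by simp
    also have "\<dots> = c" unfolding elim by simp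
    finally show ?case by (simp add: mult.commute)
  qed
  then show ?thesis unfolding g_def by (rule that)
qed

text \<open>Perturb with the multipliers 1 and \<open>\<zeta>\<close>. If both \<open>1 - \<bar>f\<bar>\<close> and \<open>(1 - \<bar>f\<bar>)\<zeta>\<close> are constant, then the
  second constant is 0, because a multiple of \<open>\<zeta>\<close> has mean 0.\<close>

lemma extreme_unimodular:
  assumes [measurable]: "f \<in> borel_measurable circle_measure"
    and le: "AE \<zeta> in circle_measure. cmod (f \<zeta>) \<le> 1"
    and ext: "extreme_point_ball_BMO f"
  shows "AE \<zeta> in circle_measure. cmod (f \<zeta>) = 1"
proof -
  obtain c where c: "AE \<zeta> in circle_measure. complex_of_real (1 - cmod (f \<zeta>)) * 1 = c"
    by (rule extreme_perturbation_constant[OF assms(1) _ le _ ext, of "\<lambda>_. 1"]) simp_all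
  obtain d where d: "AE \<zeta> in circle_measure. of_real (1 - cmod (f \<zeta>)) * \<zeta> = d"
    by (rule extreme_perturbation_constant[OF assms(1) _ le _ ext, of "\<lambda>\<zeta>. \<zeta>"]) simp_all
  have "AE \<zeta> in circle_measure. c * \<zeta> - d = 0"
    using c d by eventually_elim auto
  then have "poisson (\<lambda>\<zeta>. c * \<zeta> - d) 0 = poisson (\<lambda>\<zeta>. 0) 0"
    by (rule poisson_cong_AE) measurable
  moreover have "poisson (\<lambda>\<zeta>. c * \<zeta> - d) 0 = c * 0 - d"
    by (rule poisson_holomorphic) (auto intro!: continuous_intros holomorphic_intros)
  ultimately have "d = 0" by simp
  from d AE_space show ?thesis
  proof eventually_elim
    case (elim \<zeta>)
    then have "of_real (1 - cmod (f \<zeta>)) * \<zeta> = 0" "\<zeta> \<noteq> 0"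
      using \<open>d = 0\<close> by auto
    then show ?case by (simp del: of_real_diff)
  qed
qed

lemma inner_times_blaschke_extreme:
  assumes h: "inner_function h" and B: "blaschke_product B" and nc: "\<not> poisson B constant_on ball 0 1"
  shows "extreme_point_ball_BMO (\<lambda>\<zeta>. B \<zeta> * h \<zeta>)"
proof -
  have BH: "B \<in> Hinf" and hH: "h \<in> Hinf" and hu: "AE \<zeta> in circle_measure. cmod (h \<zeta>) = 1"
    using h B by (auto simp: inner_function_def blaschke_product_def)
  then have [measurable]: "B \<in> borel_measurable circle_measure" "h \<in> borel_measurable circle_measure"
    by (auto simp: Hinf_def Linf_def)
  obtain a where a: "cmod a < 1" "poisson B a = 0"
    using blaschke_product_has_zero[OF B nc] .
  show ?thesis
  proof (rule unimodular_extreme[OF _ _ a(1)])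
    show "AE \<zeta> in circle_measure. cmod (B \<zeta> * h \<zeta>) = 1"
      using blaschke_product_unimodular[OF B] hu by eventually_elim (simp add: norm_mult)
    show "poisson (\<lambda>\<zeta>. B \<zeta> * h \<zeta>) a = 0"
      using poisson_mult[OF BH hH a(1)] a(2) by simp
  qed measurable
qed

lemma inner_of_extreme_blaschke_multiple:
  assumes h: "h \<in> Hinf" "Linf_norm h = 1" and B: "blaschke_product B"
    and ext: "extreme_point_ball_BMO (\<lambda>\<zeta>. B \<zeta> * h \<zeta>)"
  shows "inner_function h"
proof -
  have [measurable]: "B \<in> borel_measurable circle_measure" "h \<in> borel_measurable circle_measure"
    using h B by (auto simp: blaschke_product_def Hinf_def Linf_def)
  have "AE \<zeta> in circle_measure. ereal (cmod (h \<zeta>)) \<le> Linf_norm h"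
    unfolding Linf_norm_def by (rule esssup_AE)
  then have hle: "AE \<zeta> in circle_measure. cmod (h \<zeta>) \<le> 1"
    by (simp add: h(2) one_ereal_def)
  note Bu = blaschke_product_unimodular[OF B]
  have "AE \<zeta> in circle_measure. cmod (B \<zeta> * h \<zeta>) \<le> 1"
    using Bu hle by eventually_elim (simp add: norm_mult)
  then have "AE \<zeta> in circle_measure. cmod (B \<zeta> * h \<zeta>) = 1"
    by (intro extreme_unimodular ext) measurable
  then have "AE \<zeta> in circle_measure. cmod (h \<zeta>) = 1"
    using Bu by eventually_elim (simp add: norm_mult)
  with h(1) show ?thesis by (simp add: inner_function_def)
qed

theorem theorem2p12:
  fixes h :: "complex \<Rightarrow> complex"
  assumes "h \<in> Hinf" and "Linf_norm h = 1"
  shows "(inner_function h \<longleftrightarrow>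
            (\<forall>B. blaschke_product B \<and> \<not> poisson B constant_on ball 0 1 \<longrightarrow>
                 extreme_point_ball_BMO (\<lambda>\<zeta>. B \<zeta> * h \<zeta>))) \<and>
         (inner_function h \<longleftrightarrow>
            (\<exists>B. blaschke_product B \<and> extreme_point_ball_BMO (\<lambda>\<zeta>. B \<zeta> * h \<zeta>)))"
  using inner_times_blaschke_extreme[of h] inner_of_extreme_blaschke_multiple[OF assms]
    blaschke_product_id poisson_id_not_constant
  by blast

end
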